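(* The primal EASSC algorithm obtains an approximation guarantee of $O\!\left(\frac{\sqrt{n}\log n \, H_g}{1 + (\sqrt{n}\log n - 1)(1 - \kappa_f)}\right)$ for SCSC, where $H_g$ is the approximation guarantee of the submodular set cover problem. Moreover, the dual EASSC algorithm obtains a bi-criterion approximation of $\left[O\!\left(\frac{\sqrt{n}\log n}{1 + (\sqrt{n}\log n - 1)(1 - \kappa_f)}\right),\; 1 - e^{-1}\right]$.
   Context: Let $V=\{1,\dots,n\}$ and let $f,g:2^V\to\mathbb{R}$ be monotone non-decreasing normalized ($f(\emptyset)=g(\emptyset)=0$) submodular functions, with $f(j)>0$, $g(j)>0$ for all $j$. SCSC (Submodular Cost Submodular Cover) is the problem $\min\{f(X) : g(X)\ge c\}$. The total curvature of $f$ is $\kappa_f = 1 - \min_{j\in V} \frac{f(j\mid V\setminus j)}{f(j)}$, where $f(j\mid S)=f(S\cup j)-f(S)$. $H_g = H(\max_j g(j))$ with $H(d)=\sum_{i=1}^d 1/i$ (for integral $g$) is the approximation factor of the greedy algorithm for submodular set cover (minimizing a modular function subject to $g(X)\ge c$). A $[\sigma,\rho]$ bi-criterion approximation for SCSC returns $X$ with $f(X)\le \sigma f(X^* )$ and $g(X)\ge \rho c$, where $X^*$ is optimal. EASSC (Ellipsoidal Approximation based Submodular Set Cover): form the curve-normalized function $f^{\kappa}(X) = \bigl[f(X) - (1-\kappa_f)\sum_{j\in X} f(j)\bigr]/\kappa_f$, compute its ellipsoidal approximation (Goemans et al.), i.e., a modular weight vector $w^{f^\kappa}$ with $\sqrt{w^{f^\kappa}(X)}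 \le f^\kappa(X) \le O(\sqrt{n}\log n)\sqrt{w^{f^\kappa}(X)}$ for all $X$, and define the surrogate $f^{\mathrm{ea}}(X) = \kappa_f\sqrt{w^{f^\kappa}(X)} + (1-\kappa_f)\sum_{j\in X} f(j)$, which satisfies $f^{\mathrm{ea}}(X)\le f(X)\le O\!\left(\frac{\sqrt{n}\log n}{1+(\sqrt{n}\log n-1)(1-\kappa_f)}\right) f^{\mathrm{ea}}(X)$. EASSC then solves $\min\{f^{\mathrm{ea}}(X) : g(X)\ge c\}$ using the algorithm of Nikolova, which minimizes functions of the form $\sqrt{w_1(X)}+w_2(X)$ over a constraint set within a factor $\beta(1+\epsilon)$, $\beta$ being the approximation factor for minimizing a modular function over that set. In the primal variant the modular subproblems are solved by the greedy algorithm for submodular set cover; in the dual variant they are solved via the greedy algorithm for the submodular cost knapsack problem turned into a cover algorithm by increasing the budget, which gives a $[1+\epsilon, 1-e^{-1}]$ bi-criterion guarantee for submodular set cover. *)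

theory Defs
  imports "HOL-Analysis.Analysis"
begin

section \<open>Submodular functions and the SCSC problem\<close>

definition submodular_on :: "nat set \<Rightarrow> (nat set \<Rightarrow> real) \<Rightarrow> bool" where
  "submodular_on V f \<longleftrightarrow>
     (\<forall>X Y. X \<subseteq> V \<longrightarrow> Y \<subseteq> V \<longrightarrow> f (X \<union> Y) + f (X \<inter> Y) \<le> f X + f Y)"

definition positive_polymatroid :: "nat set \<Rightarrow> (nat set \<Rightarrow> real) \<Rightarrow> bool" where
  "positive_polymatroid V f \<longleftrightarrow>
     f {} = 0 \<and> mono_on (Pow V) f \<and> submodular_on V f \<and> (\<forall>j\<in>V. f {j} > 0)"

definition integral_on :: "nat set \<Rightarrow> (nat set \<Rightarrow> real) \<Rightarrow> bool" where
  "integral_on V g \<longleftrightarrow> (\<forall>X. X \<subseteq> V \<longrightarrow> g X \<in> \<int>)"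

definition marginal :: "(nat set \<Rightarrow> real) \<Rightarrow> nat \<Rightarrow> nat set \<Rightarrow> real" where
  "marginal f j S = f (insert j S) - f S"

definition curvature :: "nat set \<Rightarrow> (nat set \<Rightarrow> real) \<Rightarrow> real" where
  "curvature V f = 1 - Min ((\<lambda>j. marginal f j (V - {j}) / f {j}) ` V)"

text \<open>Only meaningful for integral \<open>g\<close>, where the floor is the identity.\<close>

definition H_factor :: "nat set \<Rightarrow> (nat set \<Rightarrow> real) \<Rightarrow> real" where
  "H_factor V g = harm (nat \<lfloor>Max ((\<lambda>j. g {j}) ` V)\<rfloor>)"

definition scsc_instance ::
    "nat set \<Rightarrow> (nat set \<Rightarrow> real) \<Rightarrow> (nat set \<Rightarrow> real) \<Rightarrow> real \<Rightarrow> bool" where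
  "scsc_instance V f g c \<longleftrightarrow>
     positive_polymatroid V f \<and> positive_polymatroid V g \<and> (\<exists>X. X \<subseteq> V \<and> g X \<ge> c)"

definition scsc_optimal ::
    "nat set \<Rightarrow> (nat set \<Rightarrow> real) \<Rightarrow> (nat set \<Rightarrow> real) \<Rightarrow> real \<Rightarrow> nat set \<Rightarrow> bool" where
  "scsc_optimal V f g c Xs \<longleftrightarrow> is_arg_min f (\<lambda>X. X \<subseteq> V \<and> g X \<ge> c) Xs"

text \<open>
  Ties in the algorithms below are broken arbitrarily, so an algorithm is represented by the set
  of its possible outputs (a predicate). A guarantee means that the algorithm does return an
  output, and that it holds for every output, however ties are broken.
\<close>

definition bicriterion_approx ::
    "real \<Rightarrow> real \<Rightarrow> nat set \<Rightarrow> (nat set \<Rightarrow> real) \<Rightarrow> (nat set \<Rightarrow> real) \<Rightarrow> real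
      \<Rightarrow> (nat set \<Rightarrow> bool) \<Rightarrow> bool" where
  "bicriterion_approx \<sigma> \<rho> V f g c output \<longleftrightarrow>
     (\<exists>X. output X) \<and>
     (\<forall>X. output X \<longrightarrow>
        X \<subseteq> V \<and> g X \<ge> \<rho> * c \<and> (\<forall>Xs. scsc_optimal V f g c Xs \<longrightarrow> f X \<le> \<sigma> * f Xs))"

abbreviation approx ::
    "real \<Rightarrow> nat set \<Rightarrow> (nat set \<Rightarrow> real) \<Rightarrow> (nat set \<Rightarrow> real) \<Rightarrow> real
      \<Rightarrow> (nat set \<Rightarrow> bool) \<Rightarrow> bool" where
  "approx \<sigma> \<equiv> bicriterion_approx \<sigma> 1"


section \<open>Algorithms for submodular set cover with modular cost \<open>w\<close>\<close>

text \<open>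
  \<open>j\<close> maximises the ratio of gain to weight among \<open>I\<close>. The comparison is cross-multiplied, so that
  for weight 0 and positive gain the ratio counts as infinite.
\<close>

definition best_ratio ::
    "(nat \<Rightarrow> real) \<Rightarrow> (nat set \<Rightarrow> real) \<Rightarrow> nat set \<Rightarrow> nat set \<Rightarrow> nat \<Rightarrow> bool" where
  "best_ratio w h S I j \<longleftrightarrow>
     j \<in> I \<and> (\<forall>i\<in>I. marginal h i S * w j \<le> marginal h j S * w i)"

text \<open>
  Greedy algorithm of Wolsey. The gain is that of \<open>min (g X) c\<close>: without the truncation, surplus
  coverage beyond \<open>c\<close> would be rewarded and the harmonic guarantee would fail.
\<close>

inductive cover_greedy_run ::
    "nat set \<Rightarrow> (nat set \<Rightarrow> real) \<Rightarrow> real \<Rightarrow> (nat \<Rightarrow> real) \<Rightarrow> nat set \<Rightarrow> bool"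
  for V g c w where
  init: "cover_greedy_run V g c w {}"
| step: "\<lbrakk>cover_greedy_run V g c w X; g X < c; best_ratio w (\<lambda>Y. min (g Y) c) X (V - X) j\<rbrakk>
     \<Longrightarrow> cover_greedy_run V g c w (insert j X)"

definition cover_greedy ::
    "nat set \<Rightarrow> (nat set \<Rightarrow> real) \<Rightarrow> real \<Rightarrow> (nat \<Rightarrow> real) \<Rightarrow> nat set \<Rightarrow> bool" where
  "cover_greedy V g c w X \<longleftrightarrow> cover_greedy_run V g c w X \<and> g X \<ge> c"

text \<open>
  Greedy algorithm with partial enumeration (Sviridenko) for maximising \<open>g X\<close> subject to the
  knapsack constraint \<open>sum w X \<le> b\<close>. In a run started from \<open>U\<close>, \<open>S\<close> is the current set and \<open>I\<close>
  the elements not yet considered; an element that does not fit is discarded.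
\<close>

inductive knapsack_greedy_run ::
    "nat set \<Rightarrow> (nat set \<Rightarrow> real) \<Rightarrow> (nat \<Rightarrow> real) \<Rightarrow> real \<Rightarrow> nat set \<Rightarrow> nat set \<Rightarrow> nat set \<Rightarrow> bool"
  for V g w b U where
  init: "knapsack_greedy_run V g w b U U (V - U)"
| add: "\<lbrakk>knapsack_greedy_run V g w b U S I; best_ratio w g S I j; sum w (insert j S) \<le> b\<rbrakk>
     \<Longrightarrow> knapsack_greedy_run V g w b U (insert j S) (I - {j})"
| discard: "\<lbrakk>knapsack_greedy_run V g w b U S I; best_ratio w g S I j; sum w (insert j S) > b\<rbrakk>
     \<Longrightarrow> knapsack_greedy_run V g w b U S (I - {j})"

definition knapsack_greedy ::
    "nat set \<Rightarrow> (nat set \<Rightarrow> real) \<Rightarrow> (nat \<Rightarrow> real) \<Rightarrow> real \<Rightarrow> nat set \<Rightarrow> bool" where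
  "knapsack_greedy V g w b X \<longleftrightarrow>
     (\<exists>G. let small = {U. U \<subseteq> V \<and> card U < 3 \<and> sum w U \<le> b};
              triples = {U. U \<subseteq> V \<and> card U = 3 \<and> sum w U \<le> b};
              candidates = small \<union> G ` triples
          in (\<forall>U\<in>triples. knapsack_greedy_run V g w b U (G U) {}) \<and>
             X \<in> candidates \<and> (\<forall>Y\<in>candidates. g Y \<le> g X))"

text \<open>
  The knapsack algorithm turned into a cover algorithm: starting from the least weight, the budget
  is multiplied by \<open>1 + \<epsilon>\<close> until the knapsack solution covers \<open>(1 - 1/e) c\<close>.
\<close>

inductive budget_search_run ::
    "real \<Rightarrow> nat set \<Rightarrow> (nat set \<Rightarrow> real) \<Rightarrow> real \<Rightarrow> (nat \<Rightarrow> real) \<Rightarrow> real \<Rightarrow> nat set \<Rightarrow> bool"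
  for \<epsilon> V g c w where
  init: "budget_search_run \<epsilon> V g c w (Min (w ` V)) {}"
| step: "\<lbrakk>budget_search_run \<epsilon> V g c w b X; g X < (1 - exp (- 1)) * c;
      knapsack_greedy V g w ((1 + \<epsilon>) * b) Y\<rbrakk>
     \<Longrightarrow> budget_search_run \<epsilon> V g c w ((1 + \<epsilon>) * b) Y"

definition cover_via_knapsack ::
    "real \<Rightarrow> nat set \<Rightarrow> (nat set \<Rightarrow> real) \<Rightarrow> real \<Rightarrow> (nat \<Rightarrow> real) \<Rightarrow> nat set \<Rightarrow> bool" where
  "cover_via_knapsack \<epsilon> V g c w X \<longleftrightarrow>
     (\<exists>b. budget_search_run \<epsilon> V g c w b X) \<and> g X \<ge> (1 - exp (- 1)) * c"


section \<open>Nikolova's algorithm for \<open>sqrt (w1 X) + w2 X\<close>\<close>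

definition sqrt_plus_modular ::
    "(nat \<Rightarrow> real) \<Rightarrow> (nat \<Rightarrow> real) \<Rightarrow> nat set \<Rightarrow> real" where
  "sqrt_plus_modular w1 w2 X = sqrt (sum w1 X) + sum w2 X"

text \<open>
  In the plane with coordinates \<open>s = w1 X\<close> and \<open>m = w2 X\<close>, the tangent to a level curve of
  \<open>m + sqrt s\<close> has normal \<open>(1, 1 / (2 sqrt s))\<close>, whatever the level. The modular subproblem is
  solved for each of these normals with \<open>s\<close> on a geometric grid of ratio \<open>1 + \<epsilon>\<close>, and the best
  answer is returned. Every nonzero value of \<open>w1 X\<close> lies between the least positive weight and
  \<open>w1 V\<close>; the factor 1/4 makes the first grid point also good enough for solutions
  with \<open>w1 X = 0\<close>.
\<close>

definition tangent_weights ::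
    "real \<Rightarrow> nat set \<Rightarrow> (nat \<Rightarrow> real) \<Rightarrow> (nat \<Rightarrow> real) \<Rightarrow> (nat \<Rightarrow> real) set" where
  "tangent_weights \<epsilon> V w1 w2 =
     (if \<forall>j\<in>V. w1 j = 0 then {w2}
      else let s0 = Min {w1 j | j. j \<in> V \<and> w1 j > 0} / 4
           in {(\<lambda>j. w2 j + w1 j / (2 * sqrt s)) | s.
                 \<exists>k::nat. s = s0 * (1 + \<epsilon>) ^ k \<and> s \<le> (1 + \<epsilon>) * sum w1 V})"

text \<open>\<open>alg w X\<close>: the algorithm for the modular subproblem with weights \<open>w\<close> may return \<open>X\<close>.\<close>

definition nikolova ::
    "real \<Rightarrow> nat set \<Rightarrow> ((nat \<Rightarrow> real) \<Rightarrow> nat set \<Rightarrow> bool) \<Rightarrow> (nat \<Rightarrow> real) \<Rightarrow> (nat \<Rightarrow> real)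
      \<Rightarrow> nat set \<Rightarrow> bool" where
  "nikolova \<epsilon> V alg w1 w2 X \<longleftrightarrow>
     (\<exists>A. (\<forall>w\<in>tangent_weights \<epsilon> V w1 w2. alg w (A w)) \<and>
          X \<in> A ` tangent_weights \<epsilon> V w1 w2 \<and>
          (\<forall>Y\<in>A ` tangent_weights \<epsilon> V w1 w2.
             sqrt_plus_modular w1 w2 X \<le> sqrt_plus_modular w1 w2 Y))"


section \<open>EASSC\<close>

text \<open>
  For \<open>curvature V f = 0\<close> (\<open>f\<close> modular) the quotient is 0 by the convention \<open>x / 0 = 0\<close>; it is then
  multiplied by \<open>curvature V f\<close> in the surrogate, so that its value is irrelevant.
\<close>

definition curve_normalized :: "nat set \<Rightarrow> (nat set \<Rightarrow> real) \<Rightarrow> nat set \<Rightarrow> real" where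
  "curve_normalized V f X =
     (f X - (1 - curvature V f) * (\<Sum>j\<in>X. f {j})) / curvature V f"

definition ellipsoidal_approx ::
    "real \<Rightarrow> nat set \<Rightarrow> (nat set \<Rightarrow> real) \<Rightarrow> (nat \<Rightarrow> real) \<Rightarrow> bool" where
  "ellipsoidal_approx C V h w \<longleftrightarrow>
     (\<forall>j\<in>V. w j \<ge> 0) \<and>
     (\<forall>X. X \<subseteq> V \<longrightarrow>
        sqrt (sum w X) \<le> h X \<and>
        h X \<le> C * (sqrt (card V) * ln (card V)) * sqrt (sum w X))"

definition surrogate :: "nat set \<Rightarrow> (nat set \<Rightarrow> real) \<Rightarrow> (nat \<Rightarrow> real) \<Rightarrow> nat set \<Rightarrow> real" where
  "surrogate V f w X =
     curvature V f * sqrt (sum w X) + (1 - curvature V f) * (\<Sum>j\<in>X. f {j})"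

lemma surrogate_eq_sqrt_plus_modular:
  assumes "curvature V f \<ge> 0"
  shows "surrogate V f w =
    sqrt_plus_modular (\<lambda>j. (curvature V f)\<^sup>2 * w j) (\<lambda>j. (1 - curvature V f) * f {j})"
  using assms
  by (auto simp: fun_eq_iff surrogate_def sqrt_plus_modular_def real_sqrt_mult
      simp flip: sum_distrib_left)

text \<open>\<open>w\<close> is the weight vector of the ellipsoidal approximation of \<open>curve_normalized V f\<close>.\<close>

definition eassc ::
    "real \<Rightarrow> nat set \<Rightarrow> (nat set \<Rightarrow> real) \<Rightarrow> (nat \<Rightarrow> real)
      \<Rightarrow> ((nat \<Rightarrow> real) \<Rightarrow> nat set \<Rightarrow> bool) \<Rightarrow> nat set \<Rightarrow> bool" where
  "eassc \<epsilon> V f w alg =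
     nikolova \<epsilon> V alg (\<lambda>j. (curvature V f)\<^sup>2 * w j) (\<lambda>j. (1 - curvature V f) * f {j})"

definition primal_eassc ::
    "real \<Rightarrow> nat set \<Rightarrow> (nat set \<Rightarrow> real) \<Rightarrow> (nat set \<Rightarrow> real) \<Rightarrow> real \<Rightarrow> (nat \<Rightarrow> real)
      \<Rightarrow> nat set \<Rightarrow> bool" where
  "primal_eassc \<epsilon> V f g c w = eassc \<epsilon> V f w (cover_greedy V g c)"

definition dual_eassc ::
    "real \<Rightarrow> nat set \<Rightarrow> (nat set \<Rightarrow> real) \<Rightarrow> (nat set \<Rightarrow> real) \<Rightarrow> real \<Rightarrow> (nat \<Rightarrow> real)
      \<Rightarrow> nat set \<Rightarrow> bool" where
  "dual_eassc \<epsilon> V f g c w = eassc \<epsilon> V f w (cover_via_knapsack \<epsilon> V g c)"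

end

theory Submission
  imports Defs
begin

text \<open>
  If the modular subproblem is solved within a factor \<open>\<beta>\<close> for all positive weights, the tangent
  grid minimises the surrogate within \<open>(1 + \<epsilon>) \<beta>\<close>, and the surrogate approximates \<open>f\<close> within
  \<open>O(L / (1 + (L - 1) (1 - \<kappa>)))\<close> for \<open>L = sqrt n * ln n\<close>, because \<open>f\<close> lies between
  \<open>(1 - \<kappa>) m\<close> and \<open>m\<close>, where \<open>m X\<close> is the sum of the singleton values. The ellipsoidal bound on
  singletons makes all tangent weights positive. For the greedy cover algorithm Wolsey's charging
  argument gives \<open>\<beta> = 3 H\<close>; the factor 3 absorbs thresholds \<open>c\<close> that are not integers. For the
  budget search Sviridenko's argument shows that every budget of at least the cost of a cover
  yields coverage \<open>(1 - 1/e) c\<close>, so the search stops within a factor \<open>\<beta> = 1 + \<epsilon>\<close> of that cost.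
\<close>

section \<open>Marginals of monotone submodular functions\<close>

lemma submodular_onD:
  assumes "submodular_on V h" "X \<subseteq> V" "Y \<subseteq> V"
  shows "h (X \<union> Y) + h (X \<inter> Y) \<le> h X + h Y"
  using assms by (auto simp: submodular_on_def)

lemma marginal_nonneg:
  assumes "mono_on (Pow V) h" "S \<subseteq> V" "j \<in> V"
  shows "0 \<le> marginal h j S"
  using mono_onD[OF assms(1), of S "insert j S"] assms(2,3) by (auto simp: marginal_def)

text \<open>For \<open>j\<close> outside \<open>T\<close> this is submodularity applied to
  \<open>insert j S\<close> and \<open>T\<close>. For \<open>j \<in> T\<close> the left side is 0
  and monotonicity takes over, so uses need not ask whether \<open>j\<close> lies in
  \<open>T\<close>.\<close>

lemma marginal_antimono:
  assumes "submodular_on V h" "mono_on (Pow V) h" "S \<subseteq> T" "T \<subseteq> V" "j \<in> V"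
  shows "marginal h j T \<le> marginal h j S"
proof (cases "j \<in> T")
  case True
  then have "marginal h j T = 0" by (simp add: marginal_def insert_absorb)
  then show ?thesis using marginal_nonneg[OF assms(2), of S j] assms by auto
next
  case False
  have "h (insert j S \<union> T) + h (insert j S \<inter> T) \<le> h (insert j S) + h T"
    using assms by (intro submodular_onD[OF assms(1)]) auto
  moreover have "insert j S \<union> T = insert j T" "insert j S \<inter> T = S"
    using False assms(3) by auto
  ultimately show ?thesis by (simp add: marginal_def)
qed

lemma union_diff_le_sum_marginal:
  assumes "finite A" "submodular_on V h" "mono_on (Pow V) h" "S \<subseteq> V" "A \<subseteq> V"
  shows "h (S \<union> A) - h S \<le> (\<Sum>j\<in>A. marginal h j S)"
  using assms(1,5)
proof (induction A rule: finite_induct)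
  case (insert j A)
  have "marginal h j (S \<union> A) \<le> marginal h j S"
    by (rule marginal_antimono[OF assms(2,3)]) (use insert assms(4) in auto)
  with insert show ?case by (simp add: marginal_def)
qed simp

text \<open>Both greedy analyses use this to bound the remaining deficit of \<open>S\<close> against
  a comparison set \<open>T\<close>: elements of \<open>T\<close> added one by one gain at most what
  each gains at \<open>S\<close>.\<close>

lemma diff_le_sum_marginal:
  assumes "finite V" "submodular_on V h" "mono_on (Pow V) h" "S \<subseteq> V" "T \<subseteq> V"
  shows "h T - h S \<le> (\<Sum>j\<in>T - S. marginal h j S)"
proof -
  have "h T \<le> h (S \<union> (T - S))"
    by (rule mono_onD[OF assms(3)]) (use assms in auto)
  with union_diff_le_sum_marginal[of "T - S" V h S] show ?thesis
    using assms finite_subset[of "T - S" V] by fastforce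
qed

lemma mono_on_truncate:
  assumes "mono_on (Pow V) g"
  shows "mono_on (Pow V) (\<lambda>X. min (g X) (c::real))"
  by (intro mono_onI min.mono mono_onD[OF assms]) auto

text \<open>If \<open>X\<close> or \<open>Y\<close> reaches \<open>c\<close>, so does the union; two
  values \<open>c\<close> cancel and monotonicity finishes. Otherwise the cut leaves the right side
  alone and can only lower the left.\<close>

lemma submodular_on_truncate:
  assumes "submodular_on V g" "mono_on (Pow V) g"
  shows "submodular_on V (\<lambda>X. min (g X) c)"
  unfolding submodular_on_def
proof (intro allI impI)
  fix X Y assume XY: "X \<subseteq> V" "Y \<subseteq> V"
  have "g (X \<inter> Y) \<le> g X" "g (X \<inter> Y) \<le> g Y" "g X \<le> g (X \<union> Y)" "g Y \<le> g (X \<union> Y)"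
    by (rule mono_onD[OF assms(2)]; use XY in auto)+
  moreover have "g (X \<union> Y) + g (X \<inter> Y) \<le> g X + g Y"
    using submodular_onD[OF assms(1) XY] .
  ultimately show "min (g (X \<union> Y)) c + min (g (X \<inter> Y)) c \<le> min (g X) c + min (g Y) c"
    by (auto simp: min_def)
qed

text \<open>Positive weights make the cross-multiplied comparison one of quotients, which are
  linearly ordered.\<close>

lemma ex_best_ratio:
  assumes "finite I" "I \<noteq> {}" "\<And>i. i \<in> I \<Longrightarrow> w i > 0"
  shows "\<exists>j. best_ratio w h S I j"
proof -
  obtain j where j: "is_arg_min (\<lambda>i. - (marginal h i S / w i)) (\<lambda>i. i \<in> I) j"
    using ex_is_arg_min_if_finite[OF assms(1,2)] by blast
  have "marginal h i S * w j \<le> marginal h j S * w i" if "i \<in> I" for i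
  proof -
    have "marginal h i S / w i \<le> marginal h j S / w j"
      using j that by (auto simp: is_arg_min_linorder)
    then show ?thesis using assms(3) that j
      by (auto simp: is_arg_min_linorder field_simps)
  qed
  then show ?thesis using j by (auto simp: best_ratio_def is_arg_min_linorder)
qed

section \<open>Wolsey's greedy cover algorithm\<close>

text \<open>A drop from \<open>a\<close> to \<open>b\<close> must release at least the relative drop
  \<open>(a - b) / a\<close>, which is at most 1. The logarithm does so above 1; jumps of height 1
  at 0 and at 1 pay for the drops that cross them.\<close>

definition wolsey_potential :: "real \<Rightarrow> real" where
  "wolsey_potential x = (if x \<le> 0 then 0 else if x < 1 then 1 else 2 + ln x)"

text \<open>The potential is constant strictly between 0 and 1, so a partial drop there could not be
  paid for; the last hypothesis excludes it.\<close>

lemma wolsey_potential_diff: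
  assumes "0 \<le> b" "b \<le> a" "a > 0" "a < 1 \<Longrightarrow> b = 0 \<or> b = a"
  shows "(a - b) / a \<le> wolsey_potential a - wolsey_potential b"
proof -
  consider "b = 0" | "b = a" | "b > 0" "a \<ge> 1" using assms by force
  then show ?thesis
  proof cases
    case 3
    show ?thesis
    proof (cases "b < 1")
      case True
      have "(a - b) / a \<le> 1" using 3 by (simp add: divide_le_eq)
      moreover have "ln a \<ge> 0" using 3 by simp
      ultimately have "(a - b) / a \<le> 1 + ln a" by linarith
      then show ?thesis using True 3 by (simp add: wolsey_potential_def)
    next
      case False
      have "ln (b / a) \<le> b / a - 1" using 3 by (intro ln_le_minus_one) auto
      moreover have "(a - b) / a = 1 - b / a" using 3 by (simp add: field_simps)
      ultimately show ?thesis using False 3 by (simp add: wolsey_potential_def ln_div)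
    qed
  qed (use assms in \<open>auto simp: wolsey_potential_def not_less add_nonneg_nonneg\<close>)
qed

text \<open>A marginal of the truncation is fractional only if its upper end is cut off at \<open>c\<close>, so the
  only marginal below 1 besides 0 is the fractional part of \<open>c\<close>.\<close>

lemma truncated_marginal_less_one:
  assumes "integral_on V g" "mono_on (Pow V) g" "X \<subseteq> V" "i \<in> V"
    and "marginal (\<lambda>Y. min (g Y) c) i X < 1"
  shows "marginal (\<lambda>Y. min (g Y) c) i X \<in> {0, frac c}"
proof -
  have "g X \<in> \<int>" "g (insert i X) \<in> \<int>" using assms by (auto simp: integral_on_def)
  then obtain p q where pq: "g X = of_int p" "g (insert i X) = of_int q"
    by (auto elim!: Ints_cases)
  have "p \<le> q" using mono_onD[OF assms(2), of X "insert i X"] assms pq by auto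
  consider "c \<le> of_int p" | "of_int p < c" "c < of_int q" | "of_int q \<le> c" by linarith
  then show ?thesis
  proof cases
    case 2
    then have "\<lfloor>c\<rfloor> = p" using assms(5) pq by (auto simp: marginal_def floor_eq_iff)
    then show ?thesis using 2 pq by (auto simp: marginal_def frac_def)
  qed (use pq assms(5) \<open>p \<le> q\<close> in \<open>auto simp: marginal_def min_def\<close>)
qed

text \<open>Here \<open>\<theta>\<close> is the cost per unit of coverage in the last step. It never decreases along the
  run, and by summation by parts the total cost is charged to the elements of the cover \<open>Z\<close>.\<close>

lemma cover_greedy_run_invariant:
  fixes g :: "nat set \<Rightarrow> real" and c :: real
  defines "a \<equiv> marginal (\<lambda>Y. min (g Y) c)"
  assumes V: "finite V" and g: "positive_polymatroid V g" "integral_on V g"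
    and w: "\<And>j. j \<in> V \<Longrightarrow> w j > 0" and Z: "Z \<subseteq> V" "g Z \<ge> c"
    and run: "cover_greedy_run V g c w X"
  shows "X \<subseteq> V \<and> (\<exists>\<theta>\<ge>0. (\<forall>i\<in>V. \<theta> * a i X \<le> w i) \<and>
    sum w X + \<theta> * (c - min (g X) c) \<le>
      (\<Sum>i\<in>Z. w i * (wolsey_potential (a i {}) - wolsey_potential (a i X)) + \<theta> * a i X))"
  using run
proof induction
  case init
  \<comment> \<open>No step has set a price yet; \<open>\<theta> = 0\<close> turns the inequality
    into \<open>0 \<le> 0\<close>.\<close>
  show ?case
    by (intro conjI exI[of _ 0]) (use w in \<open>auto intro: less_imp_le\<close>)
next
  case (step X j)
  let ?h = "\<lambda>Y. min (g Y) c"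
  let ?P = wolsey_potential
  have gm: "mono_on (Pow V) g" and gs: "submodular_on V g"
    using g by (auto simp: positive_polymatroid_def)
  note hm = mono_on_truncate[OF gm, of c] and hs = submodular_on_truncate[OF gs gm, of c]
  from step.IH obtain \<theta> where X: "X \<subseteq> V" and \<theta>: "\<theta> \<ge> 0" "\<And>i. i \<in> V \<Longrightarrow> \<theta> * a i X \<le> w i"
    and IH: "sum w X + \<theta> * (c - min (g X) c) \<le>
      (\<Sum>i\<in>Z. w i * (?P (a i {}) - ?P (a i X)) + \<theta> * a i X)" by blast
  have j: "j \<in> V" "j \<notin> X" and best: "\<And>i. i \<in> V - X \<Longrightarrow> a i X * w j \<le> a j X * w i"
    using step.hyps(3) by (auto simp: best_ratio_def a_def)
  let ?X = "insert j X"
  have X': "?X \<subseteq> V" using X j by auto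
  have fZ: "finite Z" and fX: "finite X" using V Z X finite_subset by blast+
  have a0: "a i X = 0" if "i \<in> X" for i using that by (simp add: a_def marginal_def insert_absorb)
  have an: "0 \<le> a i ?X" "a i ?X \<le> a i X" if "i \<in> V" for i
    unfolding a_def using that X'
    by (auto intro!: marginal_nonneg[OF hm] marginal_antimono[OF hs hm])
  have "c - min (g X) c \<le> (\<Sum>i\<in>Z - X. a i X)"
    using diff_le_sum_marginal[OF V hs hm X Z(1)] Z(2) by (simp add: a_def)
  also have "\<dots> = (\<Sum>i\<in>Z. a i X)"
    using a0 fZ by (intro sum.mono_neutral_left) auto
  finally have res: "c - min (g X) c \<le> (\<Sum>i\<in>Z. a i X)" .
  \<comment> \<open>Otherwise the greedy choice would force all marginals of \<open>Z\<close> to be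
    nonpositive, although by \<open>res\<close> they add up to at least the positive residual
    demand.\<close>
  have pos: "a j X > 0"
  proof (rule ccontr)
    assume n: "\<not> a j X > 0"
    have "a i X \<le> 0" if "i \<in> Z" for i
    proof (cases "i \<in> X")
      case False
      have "a i X * w j \<le> a j X * w i" using best that False Z by auto
      also have "\<dots> \<le> 0" 
        using n w[of i] that Z by (intro mult_nonpos_nonneg) (auto intro: less_imp_le)
      finally show ?thesis using w[OF j(1)] by (simp add: mult_le_0_iff)
    qed (simp add: a0)
    then have "(\<Sum>i\<in>Z. a i X) \<le> 0" by (rule sum_nonpos)
    with res step.hyps(2) show False by simp
  qed
  \<comment> \<open>The price per unit of truncated coverage in this step. It is at least
    \<open>\<theta>\<close> by the invariant for \<open>j\<close>, and by the greedy choice no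
    element of \<open>V\<close> sells coverage more cheaply.\<close>
  define \<theta>' where "\<theta>' = w j / a j X"
  have \<theta>'0: "\<theta>' \<ge> 0" using pos w[OF j(1)] by (simp add: \<theta>'_def)
  have le: "\<theta> \<le> \<theta>'" using \<theta>(2)[OF j(1)] pos by (simp add: \<theta>'_def field_simps)
  have bd: "\<theta>' * a i X \<le> w i" if "i \<in> V" for i
  proof (cases "i \<in> X")
    case True then show ?thesis using a0 w[OF that] by simp
  next
    case False then show ?thesis using best[of i] that pos by (simp add: \<theta>'_def field_simps)
  qed
  have bd': "\<theta>' * a i ?X \<le> w i" if "i \<in> V" for i
    using bd[OF that] mult_left_mono[OF an(2)[OF that] \<theta>'0] by linarith
  have wj: "w j = \<theta>' * (min (g ?X) c - min (g X) c)"
  proof -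
    have "w j = \<theta>' * a j X" using pos by (simp add: \<theta>'_def)
    then show ?thesis by (simp only: a_def marginal_def)
  qed
  \<comment> \<open>At price \<open>\<theta>'\<close> the weight of \<open>j\<close> equals the
    demand it removes. So only the rise in price from \<open>\<theta>\<close> to
    \<open>\<theta>'\<close> on the old residual demand has to be charged, and \<open>res\<close>
    distributes it over \<open>Z\<close>.\<close>
  have "sum w ?X + \<theta>' * (c - min (g ?X) c) = sum w X + \<theta>' * (c - min (g X) c)"
    using j fX by (simp add: wj algebra_simps)
  also have "\<dots> = sum w X + \<theta> * (c - min (g X) c) + (\<theta>' - \<theta>) * (c - min (g X) c)"
    by (simp add: algebra_simps)
  also have "\<dots> \<le> (\<Sum>i\<in>Z. w i * (?P (a i {}) - ?P (a i X)) + \<theta> * a i X)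
      + (\<theta>' - \<theta>) * (\<Sum>i\<in>Z. a i X)"
    using IH mult_left_mono[OF res, of "\<theta>' - \<theta>"] le by linarith
  also have "\<dots> = (\<Sum>i\<in>Z. w i * (?P (a i {}) - ?P (a i X)) + \<theta>' * a i X)"
    unfolding sum_distrib_left sum.distrib[symmetric] by (rule sum.cong) (auto simp: algebra_simps)
  also have "\<dots> \<le> (\<Sum>i\<in>Z. w i * (?P (a i {}) - ?P (a i ?X)) + \<theta>' * a i ?X)"
  proof (rule sum_mono)
    fix i assume "i \<in> Z"
    then have i: "i \<in> V" using Z by auto
    \<comment> \<open>As \<open>\<theta>' \<le> w i / a i X\<close>, the lost marginal costs at most
      \<open>w i\<close> times its relative drop, which the potential pays for.\<close>
    have "\<theta>' * (a i X - a i ?X) \<le> w i * (?P (a i X) - ?P (a i ?X))"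
    proof (cases "a i X > 0")
      case True
      \<comment> \<open>Below 1 both marginals lie in \<open>{0, frac c}\<close>, and
        \<open>a i X\<close> is positive, hence equal to \<open>frac c\<close>.\<close>
      have "a i ?X = 0 \<or> a i ?X = a i X" if "a i X < 1"
        using truncated_marginal_less_one[OF g(2) gm X i, of c]
          truncated_marginal_less_one[OF g(2) gm X' i, of c] that an[OF i] True
        by (auto simp: a_def)
      then have "(a i X - a i ?X) / a i X \<le> ?P (a i X) - ?P (a i ?X)"
        using an[OF i] True by (intro wolsey_potential_diff) auto
      then have "w i * ((a i X - a i ?X) / a i X) \<le> w i * (?P (a i X) - ?P (a i ?X))"
        using w[OF i] by (intro mult_left_mono) auto
      moreover have "\<theta>' \<le> w i / a i X" using bd[OF i] True by (simp add: field_simps)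
      then have "\<theta>' * (a i X - a i ?X) \<le> w i / a i X * (a i X - a i ?X)"
        using an[OF i] by (intro mult_right_mono) auto
      ultimately show ?thesis by simp
    next
      case False
      then have "a i X = 0" "a i ?X = 0" using an[OF i] by auto
      then show ?thesis by simp
    qed
    then show "w i * (?P (a i {}) - ?P (a i X)) + \<theta>' * a i X
      \<le> w i * (?P (a i {}) - ?P (a i ?X)) + \<theta>' * a i ?X" by (simp add: algebra_simps)
  qed
  finally show ?case using X' \<theta>'0 bd' by blast
qed

text \<open>This lets the constant in \<open>wolsey_potential\<close> be absorbed by
  \<open>2 + H \<le> 3 * H\<close>. A positive integral value is at least 1, so the harmonic sum has
  its first term.\<close>

lemma one_le_H_factor:
  assumes "finite V" "V \<noteq> {}" "positive_polymatroid V g" "integral_on V g"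
  shows "1 \<le> H_factor V g"
proof -
  let ?M = "Max ((\<lambda>j. g {j}) ` V)"
  obtain j where j: "j \<in> V" using assms by auto
  then have "g {j} \<in> \<int>" "g {j} > 0" using assms by (auto simp: integral_on_def positive_polymatroid_def)
  then have "1 \<le> g {j}" by (auto elim!: Ints_cases)
  also have "g {j} \<le> ?M" using assms j by auto
  finally have "nat \<lfloor>?M\<rfloor> \<ge> 1" by (simp add: le_nat_iff le_floor_iff)
  then have "harm 1 \<le> (harm (nat \<lfloor>?M\<rfloor>) :: real)" by (rule harm_mono)
  then show ?thesis by (simp add: H_factor_def harm_def)
qed

text \<open>Once \<open>X\<close> covers, the residual demand and all truncated marginals are 0, so
  the invariant leaves only the initial potentials of the elements of \<open>Z\<close>, each at most
  \<open>2 + H\<close>.\<close>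

lemma cover_greedy_approx:
  assumes V: "finite V" and g: "positive_polymatroid V g" "integral_on V g"
    and w: "\<And>j. j \<in> V \<Longrightarrow> w j > 0" and Z: "Z \<subseteq> V" "g Z \<ge> c"
    and X: "cover_greedy V g c w X"
  shows "X \<subseteq> V" "g X \<ge> c" "sum w X \<le> 3 * H_factor V g * sum w Z"
proof -
  let ?a = "marginal (\<lambda>Y. min (g Y) c)"
  let ?P = wolsey_potential
  have run: "cover_greedy_run V g c w X" and gX: "g X \<ge> c" using X by (auto simp: cover_greedy_def)
  from cover_greedy_run_invariant[OF V g w Z run] obtain \<theta> where XV: "X \<subseteq> V"
    and \<theta>: "sum w X + \<theta> * (c - min (g X) c) \<le>
      (\<Sum>i\<in>Z. w i * (?P (?a i {}) - ?P (?a i X)) + \<theta> * ?a i X)" by blast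
  have gm: "mono_on (Pow V) g" and g0: "g {} = 0" and gp: "\<And>j. j \<in> V \<Longrightarrow> g {j} > 0"
    using g by (auto simp: positive_polymatroid_def)
  have aX: "?a i X = 0" if "i \<in> V" for i
  proof -
    have "g X \<le> g (insert i X)" by (rule mono_onD[OF gm]) (use XV that in auto)
    with gX show ?thesis by (simp add: marginal_def)
  qed
  have "sum w X \<le> (\<Sum>i\<in>Z. w i * ?P (?a i {}))"
  proof -
    have "sum w X \<le> (\<Sum>i\<in>Z. w i * (?P (?a i {}) - ?P (?a i X)) + \<theta> * ?a i X)"
      using \<theta> gX by simp
    also have "\<dots> = (\<Sum>i\<in>Z. w i * ?P (?a i {}))"
      using aX Z by (intro sum.cong) (auto simp: wolsey_potential_def)
    finally show ?thesis .
  qed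
  also have "\<dots> \<le> (\<Sum>i\<in>Z. w i * (3 * H_factor V g))"
  proof (intro sum_mono mult_left_mono)
    fix i assume "i \<in> Z"
    then have i: "i \<in> V" using Z by auto
    let ?M = "Max ((\<lambda>j. g {j}) ` V)"
    have H: "1 \<le> H_factor V g" using one_le_H_factor[OF V _ g] i by auto
    have "?a i {} \<le> g {i}" using gp[OF i] g0 by (auto simp: marginal_def min_def)
    also have "g {i} \<le> ?M" using V i by auto
    finally have aM: "?a i {} \<le> ?M" .
    \<comment> \<open>The maximum is attained, hence integral, so the floor in
      \<open>H_factor\<close> loses nothing.\<close>
    have "?M \<in> (\<lambda>j. g {j}) ` V" using V i by (intro Max_in) auto
    then have "?M \<in> \<int>" using g(2) by (auto simp: integral_on_def)
    then obtain m where m: "?M = of_int m" by (auto elim!: Ints_cases)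
    have "?P (?a i {}) \<le> 2 + H_factor V g"
    proof (cases "?a i {} < 1")
      case True then show ?thesis using H by (auto simp: wolsey_potential_def)
    next
      case False
      then have m1: "m \<ge> 1" using aM m by linarith
      have "ln (?a i {}) \<le> ln (real (nat m))" using aM m m1 False by simp
      also have "\<dots> \<le> ln (real (nat m) + 1)" using m1 by simp
      also have "\<dots> \<le> harm (nat m)" using ln_le_harm[of "nat m"] by (simp add: add_ac)
      finally show ?thesis using False by (simp add: wolsey_potential_def H_factor_def m)
    qed
    then show "?P (?a i {}) \<le> 3 * H_factor V g" using H by linarith
    show "0 \<le> w i" using w[OF i] by simp
  qed
  also have "\<dots> = 3 * H_factor V g * sum w Z" 
    by (subst sum_distrib_right[symmetric]) simp
  finally show "sum w X \<le> 3 * H_factor V g * sum w Z" .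
  show "X \<subseteq> V" "g X \<ge> c" by fact+
qed

text \<open>By monotonicity \<open>V\<close> itself covers, so an unfinished run always has an
  element left to add.\<close>

lemma ex_cover_greedy:
  assumes "finite V" "positive_polymatroid V g"
    and w: "\<And>j. j \<in> V \<Longrightarrow> w j > 0" and Z: "Z \<subseteq> V" "g Z \<ge> c"
  shows "\<exists>X. cover_greedy V g c w X"
proof -
  have gV: "g V \<ge> c"
    using mono_onD[of "Pow V" g Z V] assms by (auto simp: positive_polymatroid_def)
  have "\<exists>Y. cover_greedy V g c w Y" if "cover_greedy_run V g c w X" "X \<subseteq> V" for X
    using that
  proof (induction "card (V - X)" arbitrary: X rule: less_induct)
    case less
    show ?case
    proof (cases "g X \<ge> c")
      case True then show ?thesis using less by (auto simp: cover_greedy_def)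
    next
      case False
      then have "V - X \<noteq> {}" using gV less.prems by auto
      then obtain j where j: "best_ratio w (\<lambda>Y. min (g Y) c) X (V - X) j"
        using ex_best_ratio[of "V - X" w] w assms(1) by blast
      then have jV: "j \<in> V - X" by (simp add: best_ratio_def)
      have "cover_greedy_run V g c w (insert j X)"
        using cover_greedy_run.step[OF less.prems(1) _ j] False by simp
      moreover have "card (V - insert j X) < card (V - X)"
        using jV assms(1) by (intro psubset_card_mono) auto
      ultimately show ?thesis using less.hyps less.prems(2) jV by blast
    qed
  qed
  then show ?thesis using cover_greedy_run.init by blast
qed

section \<open>Sviridenko's greedy knapsack algorithm\<close>

text \<open>Choose three elements of \<open>Z\<close> one after another with maximal marginal. Any
  further element gains at most each of the three increments, since it was available at each choice
  and marginals shrink; the increments telescope to \<open>g U\<close>.\<close>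

lemma greedy_triple:
  assumes V: "finite V" and g: "positive_polymatroid V g" and Z: "Z \<subseteq> V" "3 \<le> card Z"
  obtains U where "U \<subseteq> Z" "card U = 3"
    "\<And>S i. U \<subseteq> S \<Longrightarrow> S \<subseteq> V \<Longrightarrow> i \<in> Z \<Longrightarrow> 3 * marginal g i S \<le> g U"
proof -
  have gm: "mono_on (Pow V) g" and gs: "submodular_on V g" and g0: "g {} = 0"
    using g by (auto simp: positive_polymatroid_def)
  have fZ: "finite Z" using V Z finite_subset by blast
  have max: "\<exists>j\<in>Z - T. \<forall>i\<in>Z - T. marginal g i T \<le> marginal g j T" if "T \<subseteq> Z" "card T < 3" for T
  proof -
    have "Z - T \<noteq> {}"
    proof
      assume "Z - T = {}"
      then have "card Z \<le> card T" using fZ that by (intro card_mono) (auto intro: finite_subset)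
      then show False using that Z by simp
    qed
    then obtain j where "is_arg_min (\<lambda>i. - marginal g i T) (\<lambda>i. i \<in> Z - T) j"
      using ex_is_arg_min_if_finite[of "Z - T"] fZ by blast
    then show ?thesis by (auto simp: is_arg_min_linorder)
  qed
  obtain p where p: "p \<in> Z" "\<And>i. i \<in> Z \<Longrightarrow> marginal g i {} \<le> marginal g p {}"
    using max[of "{}"] by auto
  obtain q where q: "q \<in> Z - {p}" "\<And>i. i \<in> Z - {p} \<Longrightarrow> marginal g i {p} \<le> marginal g q {p}"
    using max[of "{p}"] p by auto
  obtain r where r: "r \<in> Z - {q, p}"
      "\<And>i. i \<in> Z - {q, p} \<Longrightarrow> marginal g i {q, p} \<le> marginal g r {q, p}"
    using max[of "{q, p}"] p q by auto
  show ?thesis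
  proof (rule that[of "{r, q, p}"])
    show "{r, q, p} \<subseteq> Z" "card {r, q, p} = 3" using p q r by auto
    fix S i assume S: "{r, q, p} \<subseteq> S" "S \<subseteq> V" and i: "i \<in> Z"
    show "3 * marginal g i S \<le> g {r, q, p}"
    proof (cases "i \<in> S")
      case True
      have "g {} \<le> g {r, q, p}" by (rule mono_onD[OF gm]) (use S in auto)
      then show ?thesis using True g0 by (simp add: marginal_def insert_absorb)
    next
      case False
      have le: "marginal g i S \<le> marginal g i T" if "T \<subseteq> S" for T
        using marginal_antimono[OF gs gm that S(2)] i Z by auto
      have "marginal g i S \<le> marginal g p {}" using le[of "{}"] p(2)[OF i] by simp
      moreover have "marginal g i S \<le> marginal g q {p}"
        using le[of "{p}"] q(2)[of i] i S False by fastforce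
      moreover have "marginal g i S \<le> marginal g r {q, p}"
        using le[of "{q, p}"] r(2)[of i] i S False by fastforce
      ultimately show ?thesis using g0 by (simp add: marginal_def)
    qed
  qed
qed

lemma knapsack_greedy_run_feasible:
  assumes "knapsack_greedy_run V g w b U S I" "U \<subseteq> V" "sum w U \<le> b"
  shows "U \<subseteq> S \<and> S \<subseteq> V \<and> I \<subseteq> V - S \<and> sum w S \<le> b"
  using assms by induction (auto simp: best_ratio_def)

text \<open>As long as no element of the comparison set \<open>Z\<close> has been discarded, the deficit decays
  exponentially in the weight used. When the first one is discarded, the set including that
  element would be good enough, and leaving it out loses at most \<open>g U / 3 \<le> g U / e\<close>.\<close>

lemma knapsack_greedy_run_invariant:
  assumes run: "knapsack_greedy_run V g w b U S I"
    and V: "finite V" and g: "positive_polymatroid V g"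
    and w: "\<And>j. j \<in> V \<Longrightarrow> w j > 0"
    and Z: "Z \<subseteq> V" "sum w Z \<le> b" and U: "U \<subset> Z"
    and bound: "\<And>S i. U \<subseteq> S \<Longrightarrow> S \<subseteq> V \<Longrightarrow> i \<in> Z \<Longrightarrow> 3 * marginal g i S \<le> g U"
  shows "(Z \<subseteq> S \<union> I \<and>
      g Z - g S \<le> (g Z - g U) * exp (- ((sum w S - sum w U) / (b - sum w U))))
    \<or> (1 - exp (- 1)) * g Z \<le> g S"
proof -
  have gm: "mono_on (Pow V) g" and gs: "submodular_on V g" and g0: "g {} = 0"
    using g by (auto simp: positive_polymatroid_def)
  have UV: "U \<subseteq> V" using U Z by auto
  have fin: "finite T" if "T \<subseteq> V" for T using that V finite_subset by blast
  have w0: "0 \<le> w j" if "j \<in> V" for j using w[OF that] by simp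
  \<comment> \<open>The budget left after \<open>U\<close>; it is positive because \<open>Z\<close>
    fits the budget and exceeds \<open>U\<close> by elements of positive weight.\<close>
  define B where "B = b - sum w U"
  have sumZ: "sum w (Z - U) = sum w Z - sum w U"
    using U Z fin by (intro sum_diff) auto
  have "sum w (Z - U) > 0" using U Z fin w by (intro sum_pos) auto
  then have B: "B > 0" using Z sumZ by (simp add: B_def)
  have Ub: "sum w U \<le> b" using B by (simp add: B_def)
  have UZ: "g U \<le> g Z" by (rule mono_onD[OF gm]) (use U Z in auto)
  \<comment> \<open>Stated without asking that \<open>j\<close> fits the budget, because the discard
    case applies it to the element left out.\<close>
  have step: "g Z - g (insert j S)
      \<le> (g Z - g U) * exp (- ((sum w (insert j S) - sum w U) / B))"
    if S: "U \<subseteq> S" "S \<subseteq> V" "I \<subseteq> V - S" and j: "best_ratio w g S I j" and ZI: "Z \<subseteq> S \<union> I"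
      and D: "g Z - g S \<le> (g Z - g U) * exp (- ((sum w S - sum w U) / B))" for S I j
  proof (cases "g Z - g S \<le> 0")
    \<comment> \<open>Multiplying the deficit by \<open>1 - x \<le> exp (- x)\<close> below needs a
      nonnegative deficit, hence the separate case.\<close>
    case True
    have "g S \<le> g (insert j S)"
      by (rule mono_onD[OF gm]) (use S j in \<open>auto simp: best_ratio_def\<close>)
    then have "g Z - g (insert j S) \<le> 0" using True by simp
    also have "0 \<le> (g Z - g U) * exp (- ((sum w (insert j S) - sum w U) / B))"
      using UZ by simp
    finally show ?thesis .
  next
    case False
    have jI: "j \<in> I" "j \<in> V" "j \<notin> S" using j S by (auto simp: best_ratio_def)
    have mj: "0 \<le> marginal g j S" using marginal_nonneg[OF gm S(2) jI(2)] .
    \<comment> \<open>Averaging: \<open>j\<close> has the best ratio among \<open>Z - S\<close>,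
      whose weight is at most \<open>B\<close>, so it removes at least the fraction
      \<open>w j / B\<close> of the deficit.\<close>
    have "(g Z - g S) * w j \<le> (\<Sum>i\<in>Z - S. marginal g i S) * w j"
      using diff_le_sum_marginal[OF V gs gm S(2) Z(1)] w[OF jI(2)] by simp
    also have "\<dots> = (\<Sum>i\<in>Z - S. marginal g i S * w j)" by (rule sum_distrib_right)
    also have "\<dots> \<le> (\<Sum>i\<in>Z - S. marginal g j S * w i)"
      using j ZI by (intro sum_mono) (auto simp: best_ratio_def)
    also have "\<dots> = marginal g j S * sum w (Z - S)" by (rule sum_distrib_left[symmetric])
    also have "\<dots> \<le> marginal g j S * B"
    proof (rule mult_left_mono[OF _ mj])
      have "sum w (Z - S) \<le> sum w (Z - U)"
        using S Z fin w0 by (intro sum_mono2) auto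
      then show "sum w (Z - S) \<le> B" using sumZ Z by (simp add: B_def)
    qed
    finally have "(g Z - g S) * (w j / B) \<le> marginal g j S" using B by (simp add: field_simps)
    then have "g Z - g (insert j S) \<le> (g Z - g S) * (1 - w j / B)"
      by (simp add: marginal_def algebra_simps)
    also have "\<dots> \<le> (g Z - g S) * exp (- (w j / B))"
      using exp_ge_add_one_self[of "- (w j / B)"] False by (intro mult_left_mono) auto
    also have "\<dots> \<le> (g Z - g U) * exp (- ((sum w S - sum w U) / B)) * exp (- (w j / B))"
      using D by (intro mult_right_mono) auto
    also have "\<dots> = (g Z - g U) * exp (- ((sum w S - sum w U) / B) + - (w j / B))"
      by (simp only: exp_add mult.assoc)
    also have "- ((sum w S - sum w U) / B) + - (w j / B) = - ((sum w (insert j S) - sum w U) / B)"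
      using jI fin[OF S(2)] B by (simp add: field_simps)
    finally show ?thesis .
  qed
  show ?thesis using run unfolding B_def[symmetric]
  proof induction
    case init
    show ?case using U UZ Z by auto
  next
    case (add S I j)
    note feas = knapsack_greedy_run_feasible[OF add.hyps(1) UV Ub]
    have j: "j \<in> I" using add.hyps by (simp add: best_ratio_def)
    from add.IH show ?case
    proof
      assume *: "(1 - exp (- 1)) * g Z \<le> g S"
      have "g S \<le> g (insert j S)" by (rule mono_onD[OF gm]) (use feas j in auto)
      with * show ?thesis by simp
    next
      assume "Z \<subseteq> S \<union> I \<and> g Z - g S \<le> (g Z - g U) * exp (- ((sum w S - sum w U) / B))"
      then show ?thesis using step[of S I j] feas add.hyps by auto
    qed
  next
    case (discard S I j)
    note feas = knapsack_greedy_run_feasible[OF discard.hyps(1) UV Ub]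
    have j: "j \<in> I" using discard.hyps by (simp add: best_ratio_def)
    show ?case
    proof (cases "(1 - exp (- 1)) * g Z \<le> g S \<or> j \<notin> Z")
      case True
      then show ?thesis using discard.IH by auto
    next
      case False
      then have jZ: "j \<in> Z" and IH: "Z \<subseteq> S \<union> I"
        "g Z - g S \<le> (g Z - g U) * exp (- ((sum w S - sum w U) / B))"
        using discard.IH by auto
      have "g Z - g (insert j S)
          \<le> (g Z - g U) * exp (- ((sum w (insert j S) - sum w U) / B))"
        using step[OF _ _ _ discard.hyps(2) IH] feas by blast
      \<comment> \<open>Since \<open>j\<close> overflows the budget, the weight added to
        \<open>U\<close> exceeds \<open>B\<close>, so the exponent is below -1.\<close>
      also have "\<dots> \<le> (g Z - g U) * exp (- 1)"
        using UZ discard.hyps(3) B by (intro mult_left_mono) (auto simp: B_def field_simps)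
      finally have 1: "g Z - g (insert j S) \<le> (g Z - g U) * exp (- 1)" .
      have 2: "3 * (g (insert j S) - g S) \<le> g U"
        using bound[of S j] feas jZ by (simp add: marginal_def)
      have "g {} \<le> g U" by (rule mono_onD[OF gm]) (use UV in auto)
      moreover have "1 / 3 \<le> exp (- 1 :: real)"
        using exp_le by (simp add: exp_minus field_simps)
      ultimately have "g U * (1 / 3) \<le> g U * exp (- 1)" using g0 by (intro mult_left_mono) auto
      \<comment> \<open>The deficit of \<open>S\<close> is at most
        \<open>(g Z - g U) / e + g U / 3\<close>, and this is at most \<open>g Z / e\<close> because
        \<open>e \<le> 3\<close>.\<close>
      with 1 2 have "(1 - exp (- 1)) * g Z \<le> g S" by (simp add: algebra_simps)
      then show ?thesis by simp
    qed
  qed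
qed

lemma knapsack_greedy_feasible:
  assumes "knapsack_greedy V g w b X"
  shows "X \<subseteq> V" "sum w X \<le> b"
proof -
  obtain G where "(X \<subseteq> V \<and> sum w X \<le> b) \<or>
    (\<exists>U. X = G U \<and> U \<subseteq> V \<and> sum w U \<le> b \<and> knapsack_greedy_run V g w b U (G U) {})"
    using assms unfolding knapsack_greedy_def Let_def by auto
  then have "X \<subseteq> V \<and> sum w X \<le> b" using knapsack_greedy_run_feasible[of V g w b] by metis
  then show "X \<subseteq> V" "sum w X \<le> b" by auto
qed

text \<open>A \<open>Z\<close> with fewer than three elements is enumerated outright. Otherwise
  consider the run from the triple of \<open>greedy_triple\<close>: it ends with
  \<open>I = {}\<close>, so the first alternative of the invariant becomes
  \<open>Z \<subseteq> G U\<close>.\<close>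

lemma knapsack_greedy_approx:
  assumes V: "finite V" and g: "positive_polymatroid V g"
    and w: "\<And>j. j \<in> V \<Longrightarrow> w j > 0"
    and Z: "Z \<subseteq> V" "sum w Z \<le> b" and X: "knapsack_greedy V g w b X"
  shows "(1 - exp (- 1)) * g Z \<le> g X"
proof -
  have gm: "mono_on (Pow V) g" and g0: "g {} = 0"
    using g by (auto simp: positive_polymatroid_def)
  have "g {} \<le> g Z" by (rule mono_onD[OF gm]) (use Z in auto)
  then have scale: "(1 - exp (- 1)) * g Z \<le> g Z"
    using g0 by (intro mult_left_le_one_le) auto
  have fZ: "finite Z" using V Z finite_subset by blast
  let ?triples = "{U. U \<subseteq> V \<and> card U = 3 \<and> sum w U \<le> b}"
  obtain G where run': "\<forall>U\<in>?triples. knapsack_greedy_run V g w b U (G U) {}"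
    and best: "\<forall>Y\<in>{U. U \<subseteq> V \<and> card U < 3 \<and> sum w U \<le> b} \<union> G ` ?triples. g Y \<le> g X"
    using X unfolding knapsack_greedy_def Let_def by (elim exE conjE) (rule that)
  have small: "g U \<le> g X" if "U \<subseteq> V" "card U < 3" "sum w U \<le> b" for U
    using best that by simp
  have run: "knapsack_greedy_run V g w b U (G U) {}" and large: "g (G U) \<le> g X"
    if "U \<subseteq> V" "card U = 3" "sum w U \<le> b" for U
    using run' best that by simp_all
  show ?thesis
  proof (cases "card Z < 3")
    case True then show ?thesis using small[OF Z(1) _ Z(2)] scale by linarith
  next
    case False
    then obtain U where U: "U \<subseteq> Z" "card U = 3"
      and bd: "\<And>S i. U \<subseteq> S \<Longrightarrow> S \<subseteq> V \<Longrightarrow> i \<in> Z \<Longrightarrow> 3 * marginal g i S \<le> g U"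
      using greedy_triple[OF V g Z(1)] by (metis not_less)
    have UV: "U \<subseteq> V" using U Z by auto
    have "sum w U \<le> sum w Z"
      using U Z w fZ by (intro sum_mono2) (auto intro: less_imp_le)
    then have Ub: "sum w U \<le> b" using Z by simp
    note runU = run[OF UV U(2) Ub] and largeU = large[OF UV U(2) Ub]
    have GV: "U \<subseteq> G U" "G U \<subseteq> V" using knapsack_greedy_run_feasible[OF runU UV Ub] by auto
    have cover: ?thesis if "Z \<subseteq> G U"
    proof -
      have "g Z \<le> g (G U)" by (rule mono_onD[OF gm]) (use that GV Z in auto)
      then show ?thesis using scale largeU by linarith
    qed
    show ?thesis
    proof (cases "U = Z")
      \<comment> \<open>The invariant requires \<open>U \<subset> Z\<close>; when \<open>Z\<close>
        is the triple itself, the run contains it from the start.\<close>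
      case True then show ?thesis using cover GV by auto
    next
      case False
      then have "Z \<subseteq> G U \<or> (1 - exp (- 1)) * g Z \<le> g (G U)"
        using knapsack_greedy_run_invariant[OF runU V g w Z _ bd] U by auto
      then show ?thesis using cover largeU by linarith
    qed
  qed
qed

lemma ex_knapsack_greedy_run:
  assumes "finite V" and w: "\<And>j. j \<in> V \<Longrightarrow> w j > 0"
    and "knapsack_greedy_run V g w b U S I" "I \<subseteq> V"
  shows "\<exists>T. knapsack_greedy_run V g w b U T {}"
  using assms(3,4)
proof (induction "card I" arbitrary: S I rule: less_induct)
  case less
  show ?case
  proof (cases "I = {}")
    case True then show ?thesis using less.prems by auto
  next
    case False
    have fI: "finite I" using less.prems assms(1) finite_subset by blast
    obtain j where j: "best_ratio w g S I j"
      using ex_best_ratio[OF fI False] w less.prems by blast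
    then have "j \<in> I" by (simp add: best_ratio_def)
    then have "card (I - {j}) < card I" using fI by (intro psubset_card_mono) auto
    moreover have "\<exists>T. knapsack_greedy_run V g w b U T (I - {j})"
      using knapsack_greedy_run.add[OF less.prems(1) j] knapsack_greedy_run.discard[OF less.prems(1) j]
      by (meson not_le)
    ultimately show ?thesis using less.hyps less.prems(2) by blast
  qed
qed

lemma ex_knapsack_greedy:
  assumes V: "finite V" and w: "\<And>j. j \<in> V \<Longrightarrow> w j > 0" and b: "0 \<le> b"
  shows "\<exists>X. knapsack_greedy V g w b X"
proof -
  let ?small = "{U. U \<subseteq> V \<and> card U < 3 \<and> sum w U \<le> b}"
  let ?triples = "{U. U \<subseteq> V \<and> card U = 3 \<and> sum w U \<le> b}"
  \<comment> \<open>Runs exist from every \<open>U\<close>, even one over budget, so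
    \<open>G\<close> can be chosen on all sets at once.\<close>
  have "\<forall>U. \<exists>T. knapsack_greedy_run V g w b U T {}"
  proof
    fix U
    show "\<exists>T. knapsack_greedy_run V g w b U T {}"
      by (rule ex_knapsack_greedy_run[OF V _ knapsack_greedy_run.init]) (use w in auto)
  qed
  then obtain G where G: "\<And>U. knapsack_greedy_run V g w b U (G U) {}" by metis
  have "finite ?small" "finite ?triples"
    by (rule finite_subset[of _ "Pow V"]; use V in auto)+
  then have "finite (?small \<union> G ` ?triples)" by blast
  moreover have "{} \<in> ?small \<union> G ` ?triples" using b by auto
  ultimately obtain X where
    "is_arg_min (\<lambda>Y. - g Y) (\<lambda>Y. Y \<in> ?small \<union> G ` ?triples) X"
    using ex_is_arg_min_if_finite[of "?small \<union> G ` ?triples" "\<lambda>Y. - g Y"] by blast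
  then have "X \<in> ?small \<union> G ` ?triples" "\<forall>Y\<in>?small \<union> G ` ?triples. g Y \<le> g X"
    unfolding is_arg_min_linorder by auto
  then show ?thesis using G unfolding knapsack_greedy_def Let_def by blast
qed

section \<open>Covering by increasing the knapsack budget\<close>

text \<open>The last conjunct carries the induction: a search that must go on has budget at most
  \<open>sum w Z\<close>, so one more multiplication stays within \<open>1 + \<epsilon>\<close>.
  \<open>Z\<close> is nonempty because the search starts at a positive budget.\<close>

lemma budget_search_run_invariant:
  assumes run: "budget_search_run \<epsilon> V g c w b X"
    and \<epsilon>: "\<epsilon> > 0" and V: "finite V" and g: "positive_polymatroid V g"
    and w: "\<And>j. j \<in> V \<Longrightarrow> w j > 0"
    and Z: "Z \<subseteq> V" "g Z \<ge> c" "Z \<noteq> {}"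
  shows "X \<subseteq> V \<and> sum w X \<le> b \<and> b \<le> (1 + \<epsilon>) * sum w Z \<and>
    (g X < (1 - exp (- 1)) * c \<longrightarrow> b \<le> sum w Z)"
  using run
proof induction
  case init
  obtain z where z: "z \<in> Z" using Z by auto
  have zV: "z \<in> V" using z Z by auto
  then have fV: "finite (w ` V)" "w ` V \<noteq> {}" using V by auto
  have "Min (w ` V) \<le> w z" using V zV by auto
  also have "w z \<le> sum w Z"
    using z Z V w by (intro member_le_sum) (auto intro: less_imp_le finite_subset)
  finally have 1: "Min (w ` V) \<le> sum w Z" .
  have 2: "0 < Min (w ` V)" using fV w by auto
  then have "0 \<le> \<epsilon> * sum w Z" using 1 \<epsilon> by simp
  then show ?case using 1 2 by (simp add: algebra_simps)
next
  case (step b X Y)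
  note feas = knapsack_greedy_feasible[OF step.hyps(3)]
  have "(1 + \<epsilon>) * b \<le> (1 + \<epsilon>) * sum w Z" using step \<epsilon> by simp
  moreover have "(1 + \<epsilon>) * b \<le> sum w Z" if "g Y < (1 - exp (- 1)) * c"
  proof (rule ccontr)
    assume "\<not> ?thesis"
    then have "(1 - exp (- 1)) * g Z \<le> g Y"
      using knapsack_greedy_approx[OF V g w Z(1) _ step.hyps(3)] by simp
    moreover have "(1 - exp (- 1)) * c \<le> (1 - exp (- 1)) * g Z"
      using Z by (intro mult_left_mono) auto
    ultimately show False using that by simp
  qed
  ultimately show ?case using feas by blast
qed

text \<open>Handles an empty cover, where \<open>c \<le> 0\<close>: the initial \<open>{}\<close>
  already meets the target, so no step is taken.\<close>

lemma budget_search_run_trivial: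
  assumes "budget_search_run \<epsilon> V g c w b X" "g {} = 0" "c \<le> 0"
  shows "X = {}"
  using assms
proof induction
  case (step b X Y)
  have "(1 - exp (- 1)) * c \<le> 0" using step.prems by (intro mult_nonneg_nonpos) auto
  then show ?case using step by simp
qed simp

lemma cover_via_knapsack_approx:
  assumes "\<epsilon> > 0" and V: "finite V" and g: "positive_polymatroid V g"
    and w: "\<And>j. j \<in> V \<Longrightarrow> w j > 0"
    and Z: "Z \<subseteq> V" "g Z \<ge> c" and X: "cover_via_knapsack \<epsilon> V g c w X"
  shows "X \<subseteq> V" "g X \<ge> (1 - exp (- 1)) * c" "sum w X \<le> (1 + \<epsilon>) * sum w Z"
proof -
  obtain b where run: "budget_search_run \<epsilon> V g c w b X" using X by (auto simp: cover_via_knapsack_def)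
  have "X \<subseteq> V \<and> sum w X \<le> (1 + \<epsilon>) * sum w Z"
  proof (cases "Z = {}")
    case True
    then have "X = {}"
      using budget_search_run_trivial[OF run] g Z by (auto simp: positive_polymatroid_def)
    then show ?thesis using True by simp
  next
    case False
    then show ?thesis using budget_search_run_invariant[OF run assms(1) V g w Z] by auto
  qed
  then show "X \<subseteq> V" "sum w X \<le> (1 + \<epsilon>) * sum w Z" by auto
qed (use X in \<open>auto simp: cover_via_knapsack_def\<close>)

text \<open>A search that never succeeded could be continued forever, and its geometrically growing
  budget would pass the bound of \<open>budget_search_run_invariant\<close>.\<close>

lemma ex_cover_via_knapsack:
  assumes \<epsilon>: "\<epsilon> > 0" and V: "finite V" and g: "positive_polymatroid V g"
    and w: "\<And>j. j \<in> V \<Longrightarrow> w j > 0" and Z: "Z \<subseteq> V" "g Z \<ge> c"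
  shows "\<exists>X. cover_via_knapsack \<epsilon> V g c w X"
proof (rule ccontr)
  assume no: "\<not> ?thesis"
  then have fail: "g X < (1 - exp (- 1)) * c" if "budget_search_run \<epsilon> V g c w b X" for b X
    using that by (force simp: cover_via_knapsack_def)
  have "Z \<noteq> {}"
  proof
    assume "Z = {}"
    then have "c \<le> 0" and g0: "g {} = 0" using Z g by (auto simp: positive_polymatroid_def)
    then have "(1 - exp (- 1)) * c \<le> 0" by (intro mult_nonneg_nonpos) auto
    then show False using fail[OF budget_search_run.init] g0 by simp
  qed
  then have "V \<noteq> {}" using Z by auto
  then have M: "Min (w ` V) > 0" using V w by auto
  have runs: "\<exists>X. budget_search_run \<epsilon> V g c w (Min (w ` V) * (1 + \<epsilon>) ^ k) X" for k
  proof (induction k)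
    case 0
    show ?case using budget_search_run.init[of \<epsilon> V g c w] by auto
  next
    case (Suc k)
    then obtain X where X: "budget_search_run \<epsilon> V g c w (Min (w ` V) * (1 + \<epsilon>) ^ k) X" by blast
    have "0 \<le> (1 + \<epsilon>) * (Min (w ` V) * (1 + \<epsilon>) ^ k)" using M \<epsilon> by simp
    then obtain Y where "knapsack_greedy V g w ((1 + \<epsilon>) * (Min (w ` V) * (1 + \<epsilon>) ^ k)) Y"
      using ex_knapsack_greedy[of V w] V w by blast
    from budget_search_run.step[OF X fail[OF X] this] show ?case by (auto simp: mult_ac)
  qed
  obtain k where "sum w Z / Min (w ` V) < (1 + \<epsilon>) ^ k"
    using real_arch_pow[of "1 + \<epsilon>"] \<epsilon> by auto
  then have k: "sum w Z < Min (w ` V) * (1 + \<epsilon>) ^ k" using M by (simp add: field_simps)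
  obtain X where X: "budget_search_run \<epsilon> V g c w (Min (w ` V) * (1 + \<epsilon>) ^ k) X" using runs by blast
  from budget_search_run_invariant[OF X \<epsilon> V g w Z \<open>Z \<noteq> {}\<close>] fail[OF X] k show False by auto
qed

section \<open>Nikolova's algorithm\<close>

text \<open>The \<open>s0\<close> bound inside \<open>tangent_weights\<close>, named so that facts
  about it can be stated.\<close>

definition grid_start :: "nat set \<Rightarrow> (nat \<Rightarrow> real) \<Rightarrow> real" where
  "grid_start V w1 = Min {w1 j | j. j \<in> V \<and> w1 j > 0} / 4"

lemma tangent_weights_zero:
  "\<forall>j\<in>V. w1 j = 0 \<Longrightarrow> tangent_weights \<epsilon> V w1 w2 = {w2}"
  by (simp add: tangent_weights_def)

lemma tangent_weights_nonzero:
  "\<not> (\<forall>j\<in>V. w1 j = 0) \<Longrightarrow> tangent_weights \<epsilon> V w1 w2 =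
    {(\<lambda>j. w2 j + w1 j / (2 * sqrt s)) | s.
      \<exists>k::nat. s = grid_start V w1 * (1 + \<epsilon>) ^ k \<and> s \<le> (1 + \<epsilon>) * sum w1 V}"
  unfolding tangent_weights_def grid_start_def Let_def by (simp only: if_False)

lemma grid_start:
  assumes V: "finite V" and w1: "\<And>j. j \<in> V \<Longrightarrow> 0 \<le> w1 j" and nz: "\<not> (\<forall>j\<in>V. w1 j = 0)"
  shows "grid_start V w1 > 0"
    and "Y \<subseteq> V \<Longrightarrow> sum w1 Y \<noteq> 0 \<Longrightarrow> 4 * grid_start V w1 \<le> sum w1 Y"
proof -
  let ?P = "{w1 j | j. j \<in> V \<and> w1 j > 0}"
  have fP: "finite ?P" using V by simp
  have "?P \<noteq> {}" using nz w1 by (force simp: less_le)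
  then have "Min ?P \<in> ?P" using fP by (rule Min_in[rotated])
  then have "Min ?P > 0" by auto
  then show "grid_start V w1 > 0" by (simp add: grid_start_def)
  assume Y: "Y \<subseteq> V" "sum w1 Y \<noteq> 0"
  then obtain j where j: "j \<in> Y" "w1 j \<noteq> 0" by (meson sum.neutral)
  then have "j \<in> V" "0 < w1 j" using Y w1[of j] by auto
  then have "w1 j \<in> ?P" by blast
  then have "Min ?P \<le> w1 j" using fP by simp
  also have "w1 j \<le> sum w1 Y"
    using j Y w1 V by (intro member_le_sum) (auto intro: finite_subset)
  finally show "4 * grid_start V w1 \<le> sum w1 Y" by (simp add: grid_start_def)
qed

text \<open>The cap on \<open>s\<close> bounds the exponents, and exponent 0 passes it. This ensures
  that a best answer over the grid exists.\<close>

lemma tangent_weights_finite_nonempty: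
  assumes V: "finite V" and \<epsilon>: "\<epsilon> > 0" and w1: "\<And>j. j \<in> V \<Longrightarrow> 0 \<le> w1 j"
  shows "finite (tangent_weights \<epsilon> V w1 w2)" "tangent_weights \<epsilon> V w1 w2 \<noteq> {}"
proof -
  have "finite (tangent_weights \<epsilon> V w1 w2) \<and> tangent_weights \<epsilon> V w1 w2 \<noteq> {}"
  proof (cases "\<forall>j\<in>V. w1 j = 0")
    case True then show ?thesis by (simp add: tangent_weights_zero)
  next
    case False
    define s0 where "s0 = grid_start V w1"
    note T = tangent_weights_nonzero[OF False, of \<epsilon> w2, folded s0_def]
    have s0: "s0 > 0" using grid_start(1)[OF V w1 False] by (simp add: s0_def)
    have "sum w1 V \<noteq> 0" using False w1 V by (simp add: sum_nonneg_eq_0_iff)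
    then have sV: "4 * s0 \<le> sum w1 V" using grid_start(2)[OF V w1 False, of V] by (simp add: s0_def)
    have "0 \<le> \<epsilon> * sum w1 V" using sV s0 \<epsilon> by simp
    then have "s0 \<le> (1 + \<epsilon>) * sum w1 V" using sV s0 by (simp add: algebra_simps)
    then have "(\<lambda>j. w2 j + w1 j / (2 * sqrt s0)) \<in> tangent_weights \<epsilon> V w1 w2"
      unfolding T by (auto intro!: exI[of _ s0] exI[of _ "0::nat"])
    moreover obtain N where N: "(1 + \<epsilon>) * sum w1 V / s0 < (1 + \<epsilon>) ^ N"
      using real_arch_pow[of "1 + \<epsilon>"] \<epsilon> by auto
    have "k \<le> N" if "s0 * (1 + \<epsilon>) ^ k \<le> (1 + \<epsilon>) * sum w1 V" for k
    proof -
      have "(1 + \<epsilon>) ^ k \<le> (1 + \<epsilon>) * sum w1 V / s0" using that s0 by (simp add: field_simps)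
      with N have "(1 + \<epsilon>) ^ k < (1 + \<epsilon>) ^ N" by linarith
      then show ?thesis using \<epsilon> by (simp add: power_strict_increasing_iff)
    qed
    then have "tangent_weights \<epsilon> V w1 w2
        \<subseteq> (\<lambda>k j. w2 j + w1 j / (2 * sqrt (s0 * (1 + \<epsilon>) ^ k))) ` {..N}"
      unfolding T by auto
    then have "finite (tangent_weights \<epsilon> V w1 w2)" by (rule finite_subset) simp
    ultimately show ?thesis by blast
  qed
  then show "finite (tangent_weights \<epsilon> V w1 w2)" "tangent_weights \<epsilon> V w1 w2 \<noteq> {}" by auto
qed

text \<open>The guarantees for the modular subproblem are proved for positive weights only.\<close>

lemma tangent_weights_pos:
  assumes V: "finite V" and \<epsilon>: "\<epsilon> > 0" and w1: "\<And>j. j \<in> V \<Longrightarrow> 0 \<le> w1 j"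
    and w2: "\<And>j. j \<in> V \<Longrightarrow> 0 \<le> w2 j" and pos: "\<And>j. j \<in> V \<Longrightarrow> 0 < w1 j \<or> 0 < w2 j"
    and w: "w \<in> tangent_weights \<epsilon> V w1 w2" and j: "j \<in> V"
  shows "0 < w j"
proof (cases "\<forall>j\<in>V. w1 j = 0")
  case True then show ?thesis using pos[OF j] w j by (auto simp: tangent_weights_zero)
next
  case False
  then obtain k :: nat where
    k: "w = (\<lambda>j. w2 j + w1 j / (2 * sqrt (grid_start V w1 * (1 + \<epsilon>) ^ k)))"
    using w by (auto simp: tangent_weights_nonzero)
  have "grid_start V w1 * (1 + \<epsilon>) ^ k > 0" using grid_start(1)[OF V w1 False] \<epsilon> by simp
  then show ?thesis unfolding k using w1[OF j] w2[OF j] pos[OF j]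
    by (auto intro: add_pos_nonneg add_nonneg_pos)
qed

lemma ex_nikolova:
  assumes "finite V" "\<epsilon> > 0" "\<And>j. j \<in> V \<Longrightarrow> 0 \<le> w1 j"
    and alg: "\<And>w. w \<in> tangent_weights \<epsilon> V w1 w2 \<Longrightarrow> \<exists>X. alg w X"
  shows "\<exists>X. nikolova \<epsilon> V alg w1 w2 X"
proof -
  obtain A where A: "\<And>w. w \<in> tangent_weights \<epsilon> V w1 w2 \<Longrightarrow> alg w (A w)" using alg by metis
  have T: "finite (tangent_weights \<epsilon> V w1 w2)" "tangent_weights \<epsilon> V w1 w2 \<noteq> {}"
    using tangent_weights_finite_nonempty assms(1-3) by blast+
  obtain X where "is_arg_min (sqrt_plus_modular w1 w2) (\<lambda>X. X \<in> A ` tangent_weights \<epsilon> V w1 w2) X"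
    using ex_is_arg_min_if_finite[of "A ` tangent_weights \<epsilon> V w1 w2"] T by blast
  then show ?thesis using A unfolding nikolova_def is_arg_min_linorder by blast
qed

text \<open>The tangent at \<open>s\<close> bounds \<open>sqrt (w1 Y)\<close> from above by \<open>w1 Y / (2 * sqrt s) + sqrt s / 2\<close>,
  and this bound is nearly tight for \<open>Z\<close> at the grid point just above \<open>w1 Z\<close>.\<close>

lemma ex_good_tangent_weight:
  assumes V: "finite V" and \<epsilon>: "\<epsilon> > 0" and \<beta>: "\<beta> \<ge> 1"
    and w1: "\<And>j. j \<in> V \<Longrightarrow> 0 \<le> w1 j" and w2: "\<And>j. j \<in> V \<Longrightarrow> 0 \<le> w2 j" and Z: "Z \<subseteq> V"
  shows "\<exists>w\<in>tangent_weights \<epsilon> V w1 w2. \<forall>Y. Y \<subseteq> V \<longrightarrow> sum w Y \<le> \<beta> * sum w Z \<longrightarrow>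
    sqrt_plus_modular w1 w2 Y \<le> (1 + \<epsilon>) * \<beta> * sqrt_plus_modular w1 w2 Z"
proof -
  have s1: "0 \<le> sum w1 Y" and s2: "0 \<le> sum w2 Y" if "Y \<subseteq> V" for Y
    using that w1 w2 by (auto intro!: sum_nonneg)
  have scale: "\<beta> * x \<le> (1 + \<epsilon>) * \<beta> * x" if "0 \<le> x" for x
  proof -
    have "0 \<le> \<epsilon> * (\<beta> * x)" using that \<epsilon> \<beta> by simp
    then show ?thesis by (simp add: algebra_simps)
  qed
  have sw: "sum (\<lambda>j. w2 j + w1 j / (2 * sqrt s)) Y = sum w2 Y + sum w1 Y / (2 * sqrt s)" for s Y
    by (simp add: sum.distrib sum_divide_distrib)
  show ?thesis
  proof (cases "\<forall>j\<in>V. w1 j = 0")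
    case True
    then have "sum w1 Y = 0" if "Y \<subseteq> V" for Y using that by (intro sum.neutral) auto
    then show ?thesis using scale[OF s2[OF Z]] Z
      by (force simp: tangent_weights_zero[OF True] sqrt_plus_modular_def)
  next
    case False
    define s0 where "s0 = grid_start V w1"
    have s0: "s0 > 0" using grid_start(1)[OF V w1 False] by (simp add: s0_def)
    have s0_le: "4 * s0 \<le> sum w1 Y" if "Y \<subseteq> V" "sum w1 Y \<noteq> 0" for Y
      using grid_start(2)[OF V w1 False that] by (simp add: s0_def)
    have T: "(\<lambda>j. w2 j + w1 j / (2 * sqrt (s0 * (1 + \<epsilon>) ^ k))) \<in> tangent_weights \<epsilon> V w1 w2"
      if "s0 * (1 + \<epsilon>) ^ k \<le> (1 + \<epsilon>) * sum w1 V" for k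
      using that unfolding tangent_weights_nonzero[OF False] s0_def by blast
    have "sum w1 V \<noteq> 0" using False w1 V by (simp add: sum_nonneg_eq_0_iff)
    then have sV: "4 * s0 \<le> sum w1 V" using s0_le by simp
    show ?thesis
    proof (cases "sum w1 Z = 0")
      \<comment> \<open>No grid point lies just above \<open>sum w1 Z = 0\<close>, so the first one
        is used; there the modular cost of \<open>Z\<close> is only \<open>sum w2 Z\<close>.\<close>
      case True
      have "0 \<le> \<epsilon> * sum w1 V" using sV s0 \<epsilon> by simp
      then have "s0 * (1 + \<epsilon>) ^ 0 \<le> (1 + \<epsilon>) * sum w1 V" using sV s0 by (simp add: algebra_simps)
      note T0 = T[OF this]
      have "sqrt_plus_modular w1 w2 Y \<le> (1 + \<epsilon>) * \<beta> * sqrt_plus_modular w1 w2 Z"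
        if Y: "Y \<subseteq> V" and le: "sum w2 Y + sum w1 Y / (2 * sqrt s0) \<le> \<beta> * sum w2 Z" for Y
      proof -
        \<comment> \<open>A nonzero \<open>sum w1 Y\<close> is at least \<open>4 * s0\<close>, so
          its square root is bounded without the intercept \<open>sqrt s0 / 2\<close> of the
          tangent. This is where the factor 1/4 in the grid start matters.\<close>
        have "sqrt (sum w1 Y) \<le> sum w1 Y / (2 * sqrt s0)"
        proof (cases "sum w1 Y = 0")
          case False
          let ?t = "sqrt (sum w1 Y)"
          have "sqrt (4 * s0) \<le> ?t" using s0_le[OF Y False] by simp
          then have "?t * (2 * sqrt s0) \<le> ?t * ?t"
            using s1[OF Y] by (intro mult_left_mono) (auto simp: real_sqrt_mult)
          also have "\<dots> = sum w1 Y" using s1[OF Y] by simp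
          finally show ?thesis using s0 by (simp add: field_simps)
        qed simp
        then have "sqrt_plus_modular w1 w2 Y \<le> \<beta> * sum w2 Z"
          using le by (simp add: sqrt_plus_modular_def)
        also have "\<dots> \<le> (1 + \<epsilon>) * \<beta> * sum w2 Z" using scale s2[OF Z] .
        finally show ?thesis using True by (simp add: sqrt_plus_modular_def)
      qed
      then show ?thesis using T0 True by (intro bexI[OF _ T0]) (simp add: sw)
    next
      case False
      define t where "t = sum w1 Z"
      have t: "4 * s0 \<le> t" "t > 0" using s0_le[OF Z False] s0 by (auto simp: t_def)
      obtain N where N: "t / s0 < (1 + \<epsilon>) ^ N" using real_arch_pow[of "1 + \<epsilon>"] \<epsilon> by auto
      then have "t \<le> s0 * (1 + \<epsilon>) ^ N" using s0 by (simp add: field_simps)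
      \<comment> \<open>By minimality the preceding grid point is below \<open>t\<close>, which puts
        \<open>s\<close> between \<open>t\<close> and \<open>(1 + \<epsilon>) * t\<close>. A
        predecessor exists because \<open>t \<ge> 4 * s0\<close> excludes exponent 0.\<close>
      define k where "k = (LEAST k. t \<le> s0 * (1 + \<epsilon>) ^ k)"
      have k: "t \<le> s0 * (1 + \<epsilon>) ^ k"
        unfolding k_def by (rule LeastI) fact
      have "k \<noteq> 0"
      proof
        assume "k = 0"
        then show False using k t s0 by simp
      qed
      then obtain l where l: "k = Suc l" by (cases k) auto
      have "\<not> t \<le> s0 * (1 + \<epsilon>) ^ l" using not_less_Least[of l "\<lambda>k. t \<le> s0 * (1 + \<epsilon>) ^ k"] l
        by (simp add: k_def[symmetric])
      define s where "s = s0 * (1 + \<epsilon>) ^ k"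
      have s: "t \<le> s" using k by (simp add: s_def)
      have s': "s \<le> (1 + \<epsilon>) * t"
      proof -
        have "(1 + \<epsilon>) * (s0 * (1 + \<epsilon>) ^ l) \<le> (1 + \<epsilon>) * t"
          using \<open>\<not> t \<le> s0 * (1 + \<epsilon>) ^ l\<close> \<epsilon> by (intro mult_left_mono) auto
        then show ?thesis by (simp add: s_def l mult_ac)
      qed
      have "t \<le> sum w1 V" unfolding t_def using V Z w1 by (intro sum_mono2) auto
      then have "(1 + \<epsilon>) * t \<le> (1 + \<epsilon>) * sum w1 V" using \<epsilon> by simp
      with s' have "s0 * (1 + \<epsilon>) ^ k \<le> (1 + \<epsilon>) * sum w1 V" unfolding s_def by linarith
      note Tk = T[OF this, folded s_def]
      have sq: "sqrt s > 0" "sqrt t > 0" "sqrt t \<le> sqrt s" using s t by auto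
      have sq': "sqrt s \<le> (1 + \<epsilon>) * sqrt t"
      proof -
        have "sqrt s \<le> sqrt ((1 + \<epsilon>) * t)" using s' by simp
        also have "\<dots> = sqrt (1 + \<epsilon>) * sqrt t" by (rule real_sqrt_mult)
        also have "sqrt (1 + \<epsilon>) \<le> 1 + \<epsilon>" using \<epsilon> by (intro real_le_lsqrt) (auto simp: power2_eq_square)
        finally show ?thesis using sq by simp
      qed
      have "sqrt_plus_modular w1 w2 Y \<le> (1 + \<epsilon>) * \<beta> * sqrt_plus_modular w1 w2 Z"
        if Y: "Y \<subseteq> V"
          and le: "sum w2 Y + sum w1 Y / (2 * sqrt s) \<le> \<beta> * (sum w2 Z + sum w1 Z / (2 * sqrt s))" for Y
      proof -
        define y where "y = sqrt (sum w1 Y)"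
        have y2: "sum w1 Y = y\<^sup>2" using s1[OF Y] by (simp add: y_def)
        have "0 \<le> (y - sqrt s)\<^sup>2" by simp
        then have "y * (2 * sqrt s) \<le> y\<^sup>2 + (sqrt s)\<^sup>2" by (simp add: power2_diff algebra_simps)
        then have amgm: "y \<le> sum w1 Y / (2 * sqrt s) + sqrt s / 2"
          using sq by (simp add: y2 field_simps power2_eq_square)
        \<comment> \<open>The tangent value at \<open>t\<close> is estimated in two halves of
          \<open>sqrt t\<close>: the slope term by \<open>t \<le> s\<close>, the intercept
          \<open>sqrt s / 2\<close> by \<open>sq'\<close>.\<close>
        have "t / (2 * sqrt s) \<le> t / (2 * sqrt t)"
          using sq t by (intro divide_left_mono) auto
        also have "\<dots> = sqrt t / 2" using t by (simp add: real_div_sqrt field_simps)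
        finally have "\<beta> * (sum w2 Z + t / (2 * sqrt s)) \<le> \<beta> * (sum w2 Z + sqrt t / 2)"
          using \<beta> by simp
        also have "\<dots> \<le> (1 + \<epsilon>) * \<beta> * (sum w2 Z + sqrt t / 2)"
          using scale s2[OF Z] sq by simp
        finally have 1: "\<beta> * (sum w2 Z + t / (2 * sqrt s)) \<le> (1 + \<epsilon>) * \<beta> * (sum w2 Z + sqrt t / 2)" .
        have "sqrt s / 2 \<le> (1 + \<epsilon>) * (sqrt t / 2)" using sq' by simp
        also have "\<dots> \<le> (1 + \<epsilon>) * (\<beta> * (sqrt t / 2))"
          using \<epsilon> \<beta> sq by (intro mult_left_mono) auto
        finally have 2: "sqrt s / 2 \<le> (1 + \<epsilon>) * \<beta> * (sqrt t / 2)" by (simp add: mult_ac)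
        have "y + sum w2 Y \<le> (1 + \<epsilon>) * \<beta> * (sum w2 Z + sqrt t / 2) + (1 + \<epsilon>) * \<beta> * (sqrt t / 2)"
          using amgm le 1 2 unfolding t_def by linarith
        also have "\<dots> = (1 + \<epsilon>) * \<beta> * (sqrt t + sum w2 Z)"
          by (simp only: distrib_left[symmetric]) simp
        finally show ?thesis by (simp add: sqrt_plus_modular_def y_def t_def)
      qed
      then show ?thesis by (intro bexI[OF _ Tk]) (simp add: sw)
    qed
  qed
qed

text \<open>The output is at least as good as the answer for the one weight from
  \<open>ex_good_tangent_weight\<close>.\<close>

lemma nikolova_approx:
  assumes "finite V" "\<epsilon> > 0" "\<beta> \<ge> 1"
    and "\<And>j. j \<in> V \<Longrightarrow> 0 \<le> w1 j" "\<And>j. j \<in> V \<Longrightarrow> 0 \<le> w2 j" and Z: "Z \<subseteq> V"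
    and alg: "\<And>w Y. w \<in> tangent_weights \<epsilon> V w1 w2 \<Longrightarrow> alg w Y \<Longrightarrow> Y \<subseteq> V \<and> sum w Y \<le> \<beta> * sum w Z"
    and X: "nikolova \<epsilon> V alg w1 w2 X"
  shows "sqrt_plus_modular w1 w2 X \<le> (1 + \<epsilon>) * \<beta> * sqrt_plus_modular w1 w2 Z"
proof -
  obtain w where w: "w \<in> tangent_weights \<epsilon> V w1 w2"
    "\<And>Y. Y \<subseteq> V \<Longrightarrow> sum w Y \<le> \<beta> * sum w Z \<Longrightarrow>
      sqrt_plus_modular w1 w2 Y \<le> (1 + \<epsilon>) * \<beta> * sqrt_plus_modular w1 w2 Z"
    using ex_good_tangent_weight[of V \<epsilon> \<beta> w1 w2 Z] assms(1-6) by blast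
  obtain A where A: "alg w (A w)" "sqrt_plus_modular w1 w2 X \<le> sqrt_plus_modular w1 w2 (A w)"
    using X w(1) unfolding nikolova_def by blast
  have "sqrt_plus_modular w1 w2 (A w) \<le> (1 + \<epsilon>) * \<beta> * sqrt_plus_modular w1 w2 Z"
    using w(2) alg[OF w(1) A(1)] by blast
  with A show ?thesis by linarith
qed

section \<open>Curvature and the surrogate\<close>

text \<open>The ratios in the minimum are nonnegative by monotonicity and at most 1 by
  submodularity.\<close>

lemma curvature_bounds:
  assumes V: "finite V" "V \<noteq> {}" and f: "positive_polymatroid V f"
  shows "0 \<le> curvature V f" "curvature V f \<le> 1"
    and "\<And>j. j \<in> V \<Longrightarrow> (1 - curvature V f) * f {j} \<le> marginal f j (V - {j})"
proof -
  let ?R = "(\<lambda>j. marginal f j (V - {j}) / f {j}) ` V"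
  have fm: "mono_on (Pow V) f" and fs: "submodular_on V f" and f0: "f {} = 0"
    and fp: "\<And>j. j \<in> V \<Longrightarrow> f {j} > 0"
    using f by (auto simp: positive_polymatroid_def)
  have R: "finite ?R" "?R \<noteq> {}" using V by auto
  have \<kappa>: "curvature V f = 1 - Min ?R" by (simp add: curvature_def)
  have le: "Min ?R \<le> marginal f j (V - {j}) / f {j}" if "j \<in> V" for j
    using R that by simp
  have "0 \<le> r" if "r \<in> ?R" for r
    using that fp by (auto intro!: divide_nonneg_pos marginal_nonneg[OF fm])
  then show "curvature V f \<le> 1" using R by (simp add: \<kappa>)
  obtain j where j: "j \<in> V" using V by auto
  have "marginal f j (V - {j}) \<le> marginal f j {}"
    using j by (intro marginal_antimono[OF fs fm]) auto
  then have "marginal f j (V - {j}) / f {j} \<le> 1"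
    using fp[OF j] f0 by (simp add: marginal_def)
  then show "0 \<le> curvature V f" using le[OF j] by (simp add: \<kappa>)
  show "(1 - curvature V f) * f {j} \<le> marginal f j (V - {j})" if "j \<in> V" for j
    using le[OF that] fp[OF that] by (simp add: \<kappa> field_simps)
qed

text \<open>For the lower bound, build \<open>X\<close> element by element: each \<open>j\<close>
  gains at least its marginal at \<open>V - {j}\<close>, which the curvature controls.\<close>

lemma polymatroid_between_modular:
  assumes V: "finite V" "V \<noteq> {}" and f: "positive_polymatroid V f" and X: "X \<subseteq> V"
  shows "(1 - curvature V f) * (\<Sum>j\<in>X. f {j}) \<le> f X" "f X \<le> (\<Sum>j\<in>X. f {j})"
proof -
  have fm: "mono_on (Pow V) f" and fs: "submodular_on V f" and f0: "f {} = 0"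
    using f by (auto simp: positive_polymatroid_def)
  have fX: "finite X" using V X finite_subset by blast
  show "f X \<le> (\<Sum>j\<in>X. f {j})"
    using union_diff_le_sum_marginal[OF fX fs fm _ X, of "{}"] f0 by (simp add: marginal_def)
  show "(1 - curvature V f) * (\<Sum>j\<in>X. f {j}) \<le> f X"
    using fX X
  proof (induction X rule: finite_induct)
    case (insert j X)
    have "(1 - curvature V f) * f {j} \<le> marginal f j (V - {j})"
      using curvature_bounds(3)[OF V f] insert by auto
    also have "\<dots> \<le> marginal f j X"
      using insert by (intro marginal_antimono[OF fs fm]) auto
    finally show ?case using insert by (simp add: marginal_def algebra_simps)
  qed (simp add: f0)
qed

text \<open>For curvature 0 the left side is 0, and so is the right, because the two modular bounds
  then coincide.\<close>

lemma curvature_times_curve_normalized: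
  assumes V: "finite V" "V \<noteq> {}" and f: "positive_polymatroid V f" and X: "X \<subseteq> V"
  shows "curvature V f * curve_normalized V f X = f X - (1 - curvature V f) * (\<Sum>j\<in>X. f {j})"
  using polymatroid_between_modular[OF assms]
  by (cases "curvature V f = 0") (auto simp: curve_normalized_def)

lemma surrogate_le:
  assumes V: "finite V" "V \<noteq> {}" and f: "positive_polymatroid V f" and X: "X \<subseteq> V"
    and w: "ellipsoidal_approx C V (curve_normalized V f) w"
  shows "surrogate V f w X \<le> f X"
proof -
  have "sqrt (sum w X) \<le> curve_normalized V f X" using w X by (simp add: ellipsoidal_approx_def)
  then have "curvature V f * sqrt (sum w X) \<le> curvature V f * curve_normalized V f X"
    using curvature_bounds(1)[OF V f] by (rule mult_left_mono)
  then show ?thesis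
    by (simp add: surrogate_def curvature_times_curve_normalized[OF V f X])
qed

text \<open>For \<open>n = 2\<close> the product is slightly below 1, so a weaker bound serves; it
  keeps the denominator of the guarantee positive and costs a factor 2 in
  \<open>le_surrogate\<close>.\<close>

lemma sqrt_times_ln_ge_half:
  assumes "2 \<le> (n::nat)"
  shows "1 / 2 \<le> sqrt n * ln n"
proof -
  have "ln 2 \<le> ln (real n)" using assms by simp
  then have "1 / 2 \<le> ln (real n)" using ln2_ge_two_thirds by linarith
  moreover have "1 \<le> sqrt (real n)" using assms by simp
  ultimately show ?thesis using mult_mono[of 1 "sqrt (real n)" "1/2" "ln (real n)"] by simp
qed

lemma le_surrogate:
  fixes V f
  defines "L \<equiv> sqrt (card V) * ln (card V)"
  assumes V: "finite V" "2 \<le> card V" and f: "positive_polymatroid V f" and X: "X \<subseteq> V"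
    and w: "ellipsoidal_approx C V (curve_normalized V f) w" and C: "C > 0"
  shows "f X \<le> (C + 4) * (L / (1 + (L - 1) * (1 - curvature V f))) * surrogate V f w X"
proof -
  define \<kappa> where "\<kappa> = curvature V f"
  define h where "h = curve_normalized V f X"
  define m where "m = (\<Sum>j\<in>X. f {j})"
  define s where "s = sqrt (sum w X)"
  have V': "V \<noteq> {}" using V by auto
  have L: "1 / 2 \<le> L" using sqrt_times_ln_ge_half[OF V(2)] by (simp add: L_def)
  have \<kappa>: "0 \<le> \<kappa>" "\<kappa> \<le> 1" using curvature_bounds(1,2)[OF V(1) V' f] by (auto simp: \<kappa>_def)
  have \<kappa>h: "\<kappa> * h = f X - (1 - \<kappa>) * m"
    using curvature_times_curve_normalized[OF V(1) V' f X] by (simp add: \<kappa>_def h_def m_def)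
  have fm: "f X \<le> m"
    using polymatroid_between_modular(2)[OF V(1) V' f X] by (simp add: m_def)
  have m: "0 \<le> m" unfolding m_def
    using f X by (intro sum_nonneg) (auto simp: positive_polymatroid_def intro: less_imp_le)
  have s: "0 \<le> s" "h \<le> C * L * s"
    using w X unfolding ellipsoidal_approx_def L_def s_def h_def by (auto intro!: sum_nonneg)
  have D: "0 < 1 + (L - 1) * (1 - \<kappa>)"
  proof (cases "\<kappa> = 0")
    case False
    have "0 < \<kappa> + L * (1 - \<kappa>)" using \<kappa> False L by (intro add_pos_nonneg) auto
    then show ?thesis by (simp add: algebra_simps)
  qed (use L in auto)
  have fX: "f X = \<kappa> * h + (1 - \<kappa>) * m" using \<kappa>h by simp
  have a1: "\<kappa> * (\<kappa> * h) \<le> C * L * (\<kappa> * s)"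
  proof -
    have "0 \<le> \<kappa> * (C * L * s)" using \<kappa> C L s by simp
    have "\<kappa> * (\<kappa> * h) \<le> \<kappa> * (\<kappa> * (C * L * s))" using \<kappa> s by (intro mult_left_mono) auto
    also have "\<dots> \<le> 1 * (\<kappa> * (C * L * s))" using \<kappa> \<open>0 \<le> \<kappa> * (C * L * s)\<close> by (intro mult_right_mono)
    finally show ?thesis by (simp add: mult_ac)
  qed
  \<comment> \<open>Uses \<open>\<kappa> \<le> 1 \<le> 2 * L\<close>.\<close>
  have a2: "\<kappa> * ((1 - \<kappa>) * m) \<le> 2 * L * ((1 - \<kappa>) * m)"
    using \<kappa> L m by (intro mult_right_mono) auto
  have a3: "L * (1 - \<kappa>) * f X \<le> L * ((1 - \<kappa>) * m)"
    using \<kappa> L fm by (simp add: mult_left_mono mult.assoc)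
  \<comment> \<open>The denominator is \<open>\<kappa> + L * (1 - \<kappa>)\<close>, and
    \<open>f X\<close> is estimated differently under each summand: by the ellipsoid in the first,
    by \<open>m\<close> in the second. The square root part gets factor \<open>C\<close> and the
    modular part 3; \<open>C + 4\<close> dominates both.\<close>
  have "(1 + (L - 1) * (1 - \<kappa>)) * f X = \<kappa> * f X + L * (1 - \<kappa>) * f X" by (simp add: algebra_simps)
  also have "\<kappa> * f X = \<kappa> * (\<kappa> * h) + \<kappa> * ((1 - \<kappa>) * m)" by (simp only: fX distrib_left)
  also have "\<kappa> * (\<kappa> * h) + \<kappa> * ((1 - \<kappa>) * m) + L * (1 - \<kappa>) * f X
      \<le> C * L * (\<kappa> * s) + 3 * (L * ((1 - \<kappa>) * m))" using a1 a2 a3 by linarith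
  also have "\<dots> \<le> (C + 4) * L * (\<kappa> * s) + (C + 4) * L * ((1 - \<kappa>) * m)"
  proof -
    have "0 \<le> L * (\<kappa> * s)" "0 \<le> L * ((1 - \<kappa>) * m)" "0 \<le> C * (L * ((1 - \<kappa>) * m))"
      using \<kappa> L s m C by auto
    then show ?thesis by (simp add: algebra_simps)
  qed
  also have "\<dots> = (C + 4) * L * surrogate V f w X"
    by (simp add: surrogate_def \<kappa>_def s_def m_def distrib_left)
  finally show ?thesis using D by (simp add: \<kappa>_def[symmetric] field_simps)
qed

text \<open>On singletons normalization leaves \<open>f\<close> unchanged, so the upper ellipsoidal
  bound would fail for \<open>w j = 0\<close>.\<close>

lemma ellipsoidal_weight_pos:
  assumes V: "finite V" "2 \<le> card V" and f: "positive_polymatroid V f" and j: "j \<in> V"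
    and w: "ellipsoidal_approx C V (curve_normalized V f) w" and \<kappa>: "curvature V f \<noteq> 0"
  shows "0 < w j"
proof -
  have "curve_normalized V f {j} = f {j}" using \<kappa> by (simp add: curve_normalized_def field_simps)
  moreover have "0 < f {j}" using f j by (auto simp: positive_polymatroid_def)
  moreover have "0 \<le> w j" using w j by (auto simp: ellipsoidal_approx_def)
  moreover have "curve_normalized V f {j} \<le> C * (sqrt (card V) * ln (card V)) * sqrt (sum w {j})"
    using w j unfolding ellipsoidal_approx_def by blast
  ultimately show ?thesis by (cases "w j = 0") auto
qed

section \<open>EASSC\<close>

text \<open>Serves both variants: \<open>alg\<close> stands for any solver of the modular subproblem
  that is within \<open>\<beta>\<close> of every cover \<open>Z\<close>, for positive weights. The
  factors of \<open>le_surrogate\<close> and \<open>nikolova_approx\<close> multiply, and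
  \<open>surrogate_le\<close> returns to \<open>f\<close>.\<close>

lemma eassc_bicriterion:
  fixes V f
  defines "L \<equiv> sqrt (card V) * ln (card V)"
  assumes V: "finite V" "2 \<le> card V" and inst: "scsc_instance V f g c"
    and w: "ellipsoidal_approx C V (curve_normalized V f) w"
    and C: "C > 0" and \<epsilon>: "\<epsilon> > 0" and \<beta>: "\<beta> \<ge> 1"
    and ex: "\<And>v. (\<And>j. j \<in> V \<Longrightarrow> v j > 0) \<Longrightarrow> \<exists>X. alg v X"
    and alg: "\<And>v X Z. (\<And>j. j \<in> V \<Longrightarrow> v j > 0) \<Longrightarrow> alg v X \<Longrightarrow> Z \<subseteq> V \<Longrightarrow> g Z \<ge> c \<Longrightarrow>
      X \<subseteq> V \<and> g X \<ge> \<rho> * c \<and> sum v X \<le> \<beta> * sum v Z"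
  shows "bicriterion_approx
    ((C + 4) * (1 + \<epsilon>) * \<beta> * (L / (1 + (L - 1) * (1 - curvature V f)))) \<rho> V f g c
    (eassc \<epsilon> V f w alg)"
proof -
  define \<kappa> where "\<kappa> = curvature V f"
  define R where "R = L / (1 + (L - 1) * (1 - \<kappa>))"
  define w1 where "w1 = (\<lambda>j. \<kappa>\<^sup>2 * w j)"
  define w2 where "w2 = (\<lambda>j. (1 - \<kappa>) * f {j})"
  have f: "positive_polymatroid V f" using inst by (simp add: scsc_instance_def)
  have V': "V \<noteq> {}" using V by auto
  have \<kappa>: "0 \<le> \<kappa>" "\<kappa> \<le> 1" using curvature_bounds(1,2)[OF V(1) V' f] by (auto simp: \<kappa>_def)
  have fp: "0 < f {j}" if "j \<in> V" for j using f that by (auto simp: positive_polymatroid_def)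
  have w10: "0 \<le> w1 j" if "j \<in> V" for j
    using w that by (auto simp: w1_def ellipsoidal_approx_def)
  have w20: "0 \<le> w2 j" if "j \<in> V" for j using fp[OF that] \<kappa> by (simp add: w2_def)
  \<comment> \<open>The modular part vanishes for \<open>\<kappa> = 1\<close> and the square root
    part for \<open>\<kappa> = 0\<close>, so neither alone would do.\<close>
  have pos: "0 < w1 j \<or> 0 < w2 j" if "j \<in> V" for j
  proof (cases "\<kappa> = 0")
    case True then show ?thesis using fp[OF that] by (simp add: w2_def)
  next
    case False then show ?thesis
      using ellipsoidal_weight_pos[OF V f that w] by (simp add: w1_def \<kappa>_def)
  qed
  have Tpos: "0 < v j" if "v \<in> tangent_weights \<epsilon> V w1 w2" "j \<in> V" for v j
    by (rule tangent_weights_pos[OF V(1) \<epsilon> _ _ _ that]) (use w10 w20 pos in auto)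
  have ea: "eassc \<epsilon> V f w alg = nikolova \<epsilon> V alg w1 w2"
    by (simp add: eassc_def w1_def w2_def \<kappa>_def)
  have sur: "surrogate V f w = sqrt_plus_modular w1 w2"
    using surrogate_eq_sqrt_plus_modular[of V f w] \<kappa> by (simp add: w1_def w2_def \<kappa>_def)
  have L: "1 / 2 \<le> L" using sqrt_times_ln_ge_half[OF V(2)] by (simp add: L_def)
  have "0 \<le> \<kappa> + L * (1 - \<kappa>)" using \<kappa> L by simp
  then have R: "0 \<le> R" using L unfolding R_def by (intro divide_nonneg_nonneg) (auto simp: algebra_simps)
  show ?thesis unfolding bicriterion_approx_def ea
  proof (intro conjI allI impI)
    show "\<exists>X. nikolova \<epsilon> V alg w1 w2 X"
    proof (rule ex_nikolova[OF V(1) \<epsilon>])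
      show "\<exists>X. alg v X" if "v \<in> tangent_weights \<epsilon> V w1 w2" for v
        using ex Tpos[OF that] by blast
    qed (use w10 in auto)
    fix X assume X: "nikolova \<epsilon> V alg w1 w2 X"
    then obtain v where v: "v \<in> tangent_weights \<epsilon> V w1 w2" "alg v X"
      unfolding nikolova_def by blast
    \<comment> \<open>Feasibility is claimed before an optimal set is given, so any cover serves as
      comparison set.\<close>
    obtain Y where Y: "Y \<subseteq> V" "g Y \<ge> c" using inst by (auto simp: scsc_instance_def)
    from alg[OF Tpos[OF v(1)] v(2) Y] show XV: "X \<subseteq> V" and "\<rho> * c \<le> g X" by auto
    fix Z assume "scsc_optimal V f g c Z"
    then have Z: "Z \<subseteq> V" "g Z \<ge> c" by (auto simp: scsc_optimal_def is_arg_min_def)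
    have "surrogate V f w X \<le> (1 + \<epsilon>) * \<beta> * surrogate V f w Z"
      unfolding sur
    proof (rule nikolova_approx[OF V(1) \<epsilon> \<beta> _ _ Z(1) _ X])
      show "Y \<subseteq> V \<and> sum v Y \<le> \<beta> * sum v Z"
        if v: "v \<in> tangent_weights \<epsilon> V w1 w2" and Y: "alg v Y" for v Y
        using alg[OF Tpos[OF v] Y Z] by simp
    qed (use w10 w20 in auto)
    also have "\<dots> \<le> (1 + \<epsilon>) * \<beta> * f Z"
      using surrogate_le[OF V(1) V' f Z(1) w] \<epsilon> \<beta> by (intro mult_left_mono) auto
    finally have "(C + 4) * R * surrogate V f w X \<le> (C + 4) * R * ((1 + \<epsilon>) * \<beta> * f Z)"
      using C R by (intro mult_left_mono) auto
    moreover have "f X \<le> (C + 4) * R * surrogate V f w X"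
      using le_surrogate[OF V f XV w C] by (simp add: R_def L_def \<kappa>_def)
    ultimately have "f X \<le> (C + 4) * R * ((1 + \<epsilon>) * \<beta> * f Z)" by linarith
    then show "f X \<le> (C + 4) * (1 + \<epsilon>) * \<beta> * (L / (1 + (L - 1) * (1 - curvature V f))) * f Z"
      by (simp add: R_def \<kappa>_def mult_ac)
  qed
qed

theorem theorem4:
  fixes C \<epsilon> :: real
  assumes "C > 0" and "\<epsilon> > 0"
  shows
    "(\<exists>K>0. \<forall>(n::nat) f g c w.
        n \<ge> 2 \<longrightarrow> scsc_instance {1..n} f g c \<longrightarrow> integral_on {1..n} g \<longrightarrow>
        ellipsoidal_approx C {1..n} (curve_normalized {1..n} f) w \<longrightarrow>
        approx
          (K * (sqrt n * ln n * H_factor {1..n} g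
                / (1 + (sqrt n * ln n - 1) * (1 - curvature {1..n} f))))
          {1..n} f g c (primal_eassc \<epsilon> {1..n} f g c w))
     \<and>
     (\<exists>K>0. \<forall>(n::nat) f g c w.
        n \<ge> 2 \<longrightarrow> scsc_instance {1..n} f g c \<longrightarrow>
        ellipsoidal_approx C {1..n} (curve_normalized {1..n} f) w \<longrightarrow>
        bicriterion_approx
          (K * (sqrt n * ln n / (1 + (sqrt n * ln n - 1) * (1 - curvature {1..n} f))))
          (1 - exp (- 1))
          {1..n} f g c (dual_eassc \<epsilon> {1..n} f g c w))"
proof (intro conjI)
  show "\<exists>K>0. \<forall>(n::nat) f g c w.
        n \<ge> 2 \<longrightarrow> scsc_instance {1..n} f g c \<longrightarrow> integral_on {1..n} g \<longrightarrow>
        ellipsoidal_approx C {1..n} (curve_normalized {1..n} f) w \<longrightarrow>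
        approx
          (K * (sqrt n * ln n * H_factor {1..n} g
                / (1 + (sqrt n * ln n - 1) * (1 - curvature {1..n} f))))
          {1..n} f g c (primal_eassc \<epsilon> {1..n} f g c w)"
  \<comment> \<open>The factors come from the surrogate, the tangent grid and Wolsey's bound; they
    depend only on \<open>C\<close> and \<open>\<epsilon>\<close>.\<close>
  proof (intro exI[of _ "(C + 4) * (1 + \<epsilon>) * 3"] conjI allI impI)
    fix n :: nat and f g c w
    let ?V = "{1..n}"
    assume n: "n \<ge> 2" and inst: "scsc_instance ?V f g c" and int: "integral_on ?V g"
      and w: "ellipsoidal_approx C ?V (curve_normalized ?V f) w"
    have V: "finite ?V" "2 \<le> card ?V" "?V \<noteq> {}" using n by auto
    have g: "positive_polymatroid ?V g" using inst by (simp add: scsc_instance_def)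
    obtain Y where Y: "Y \<subseteq> ?V" "g Y \<ge> c" using inst by (auto simp: scsc_instance_def)
    have \<beta>: "1 \<le> 3 * H_factor ?V g" using one_le_H_factor[OF V(1,3) g int] by simp
    have "approx ((C + 4) * (1 + \<epsilon>) * (3 * H_factor ?V g) *
        (sqrt (card ?V) * ln (card ?V) /
          (1 + (sqrt (card ?V) * ln (card ?V) - 1) * (1 - curvature ?V f))))
      ?V f g c (eassc \<epsilon> ?V f w (cover_greedy ?V g c))"
    proof (rule eassc_bicriterion[OF V(1,2) inst w assms \<beta>])
      show "\<exists>X. cover_greedy ?V g c v X" if "\<And>j. j \<in> ?V \<Longrightarrow> v j > 0" for v
        using ex_cover_greedy[OF V(1) g that Y] .
      show "X \<subseteq> ?V \<and> 1 * c \<le> g X \<and> sum v X \<le> 3 * H_factor ?V g * sum v Z"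
        if "\<And>j. j \<in> ?V \<Longrightarrow> v j > 0" "cover_greedy ?V g c v X" "Z \<subseteq> ?V" "g Z \<ge> c" for v X Z
        using cover_greedy_approx[OF V(1) g int that(1,3,4,2)] by simp
    qed
    moreover have "(C + 4) * (1 + \<epsilon>) * (3 * H_factor ?V g) * (sqrt n * ln n / D) =
      (C + 4) * (1 + \<epsilon>) * 3 * (sqrt n * ln n * H_factor ?V g / D)" for D by simp
    ultimately show "approx ((C + 4) * (1 + \<epsilon>) * 3 * (sqrt n * ln n * H_factor ?V g
        / (1 + (sqrt n * ln n - 1) * (1 - curvature ?V f)))) ?V f g c (primal_eassc \<epsilon> ?V f g c w)"
      by (simp only: primal_eassc_def card_atLeastAtMost diff_Suc_Suc diff_zero One_nat_def)
  qed (use assms in auto)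
  show "\<exists>K>0. \<forall>(n::nat) f g c w.
        n \<ge> 2 \<longrightarrow> scsc_instance {1..n} f g c \<longrightarrow>
        ellipsoidal_approx C {1..n} (curve_normalized {1..n} f) w \<longrightarrow>
        bicriterion_approx
          (K * (sqrt n * ln n / (1 + (sqrt n * ln n - 1) * (1 - curvature {1..n} f))))
          (1 - exp (- 1))
          {1..n} f g c (dual_eassc \<epsilon> {1..n} f g c w)"
  \<comment> \<open>As before, with the overshoot \<open>1 + \<epsilon>\<close> of the budget search
    in place of Wolsey's bound.\<close>
  proof (intro exI[of _ "(C + 4) * (1 + \<epsilon>) * (1 + \<epsilon>)"] conjI allI impI)
    fix n :: nat and f g c w
    let ?V = "{1..n}"
    assume n: "n \<ge> 2" and inst: "scsc_instance ?V f g c"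
      and w: "ellipsoidal_approx C ?V (curve_normalized ?V f) w"
    have V: "finite ?V" "2 \<le> card ?V" using n by auto
    have g: "positive_polymatroid ?V g" using inst by (simp add: scsc_instance_def)
    obtain Y where Y: "Y \<subseteq> ?V" "g Y \<ge> c" using inst by (auto simp: scsc_instance_def)
    have \<beta>: "1 \<le> 1 + \<epsilon>" using assms by simp
    have "bicriterion_approx ((C + 4) * (1 + \<epsilon>) * (1 + \<epsilon>) *
        (sqrt (card ?V) * ln (card ?V) /
          (1 + (sqrt (card ?V) * ln (card ?V) - 1) * (1 - curvature ?V f)))) (1 - exp (- 1))
      ?V f g c (eassc \<epsilon> ?V f w (cover_via_knapsack \<epsilon> ?V g c))"
    proof (rule eassc_bicriterion[OF V inst w assms \<beta>])
      show "\<exists>X. cover_via_knapsack \<epsilon> ?V g c v X" if "\<And>j. j \<in> ?V \<Longrightarrow> v j > 0" for v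
        using ex_cover_via_knapsack[OF assms(2) V(1) g that Y] .
      show "X \<subseteq> ?V \<and> (1 - exp (- 1)) * c \<le> g X \<and> sum v X \<le> (1 + \<epsilon>) * sum v Z"
        if "\<And>j. j \<in> ?V \<Longrightarrow> v j > 0" "cover_via_knapsack \<epsilon> ?V g c v X" "Z \<subseteq> ?V" "g Z \<ge> c" for v X Z
        using cover_via_knapsack_approx[OF assms(2) V(1) g that(1,3,4,2)] by simp
    qed
    then show "bicriterion_approx ((C + 4) * (1 + \<epsilon>) * (1 + \<epsilon>) *
        (sqrt n * ln n / (1 + (sqrt n * ln n - 1) * (1 - curvature ?V f)))) (1 - exp (- 1))
      ?V f g c (dual_eassc \<epsilon> ?V f g c w)"
      by (simp add: dual_eassc_def)
  qed (use assms in auto)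
qed

end
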